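(* Let $E,F$ be Banach spaces and let $n\in\mathbb N$ with $n<\mathrm{cd}(E)$. Suppose that there exists a metric compact approximation of the identity $(L_\beta)\subset\mathcal K(F)$ of $F$ such that $\sup_\beta\|L^\beta\|\le1$, where $L^\beta=\mathrm{Id}_F-L_\beta$, and such that for any $\varepsilon>0$ there exist $\mu>0$ and $\beta_0$ so that $$\sup_{\|y\|,\|z\|\le1}\|L_\beta y+\mu L^\beta z\|\le 1+\varepsilon\mu\quad\text{for all }\beta\ge\beta_0$$ (supremum over $y,z\in F$). Then $\mathcal P_w({}^nE,F)$ is an HB-subspace of $\mathcal P({}^nE,F)$.
   Context: All Banach spaces are over $\mathbb K=\mathbb R$ or $\mathbb C$ (the same field for $E$ and $F$); $B_E$ is the closed unit ball, and $\mathbb N=\{1,2,\dots\}$. $\mathcal P({}^nE,F)$ is the Banach space of continuous $n$-homogeneous polynomials $P:E\to F$ with norm $\|P\|=\sup_{x\in B_E}\|P(x)\|$. $\mathcal P_w({}^nE,F)$ is the subspace of those polynomials that are weakly continuous on bounded sets, i.e. that map bounded weakly convergent nets to norm-convergent nets. $\mathcal P({}^nE)$ and $\mathcal P_w({}^nE)$ denote these spaces for $F=\mathbb K$. Critical degree: $\mathrm{cd}(E):=\min\{k\in\mathbb N: \mathcal P_w({}^kE)\ne\mathcal P({}^kE)\}$ (with $\mathrm{cd}(E)=\infty$ if there is no such $k$). For a closed subspace $J$ of a Banach space $X$, $J^\perp=\{x^*\in X^*: x^*(y)=0\ \forall y\in J\}$. $J$ is an HB-subspace of $X$ if there is a linear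 projection $q$ on $X^*$ with $\ker q=J^\perp$ such that for each $f\in X^*$ with $f\ne qf$ one has $\|qf\|<\|f\|$ and $\|f-qf\|\le\|f\|$. $\mathcal K(F)$ is the space of compact operators on $F$. A metric compact approximation of the identity of $F$ is a net $(L_\beta)\subset\mathcal K(F)$ with $\sup_\beta\|L_\beta\|\le1$ and $L_\beta\to\mathrm{Id}_F$ pointwise. *)

theory Defs
  imports "HOL-Analysis.Analysis" "HOL-Library.Extended_Nat" "HOL-Library.Function_Algebras"
begin

(* Scalar fields: 'k is, as a normed field, isometrically isomorphic to R or to C. *)
class real_or_complex = real_normed_field +
  assumes ex_embedding:
    "\<exists>\<phi> :: 'a \<Rightarrow> complex.
       (\<forall>x y. \<phi> (x + y) = \<phi> x + \<phi> y) \<and> (\<forall>x y. \<phi> (x * y) = \<phi> x * \<phi> y) \<and>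
       (\<forall>r. \<phi> (scaleR r 1) = complex_of_real r) \<and> (\<forall>x. cmod (\<phi> x) = norm x) \<and>
       (range \<phi> = \<real> \<or> range \<phi> = UNIV)"

instance real :: real_or_complex
  by standard (rule exI[of _ complex_of_real], auto simp: Reals_def)

instance complex :: real_or_complex
  by standard (rule exI[of _ "\<lambda>x. x"], auto simp: scaleR_conv_of_real)

(* Completeness and the real structure of a Banach space over 'k come from the class banach of
   'a; the scalar multiplication by 'k is an explicit operation extending the real one. *)
locale banach_over = vector_space scale
  for scale :: "'k::real_or_complex \<Rightarrow> 'a::banach \<Rightarrow> 'a" +
  assumes scale_of_real: "scale (of_real r) x = r *\<^sub>R x"
    and norm_scale: "norm (scale c x) = norm c * norm x"


(* Normed spaces given by a carrier X inside an ambient group 'v, a scalar multiplication sc and a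
   norm nrm; this is needed since spaces of n-homogeneous polynomials depend on n.
   Functionals on X are normalised to vanish off X, so that equality of functionals on X is
   equality of functions and the dual is closed under the pointwise operations. *)

definition linear_on_carrier ::
  "'v::ab_group_add set \<Rightarrow> ('k \<Rightarrow> 'v \<Rightarrow> 'v) \<Rightarrow> ('k \<Rightarrow> 'w::ab_group_add \<Rightarrow> 'w) \<Rightarrow> ('v \<Rightarrow> 'w) \<Rightarrow> bool"
  where "linear_on_carrier X s1 s2 f \<longleftrightarrow>
    (\<forall>x\<in>X. \<forall>y\<in>X. f (x + y) = f x + f y) \<and> (\<forall>c. \<forall>x\<in>X. f (s1 c x) = s2 c (f x))"

definition dual ::
  "('k::real_normed_field \<Rightarrow> 'v::ab_group_add \<Rightarrow> 'v) \<Rightarrow> ('v \<Rightarrow> real) \<Rightarrow> 'v set \<Rightarrow> ('v \<Rightarrow> 'k) set"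
  where "dual sc nrm X =
    {f. linear_on_carrier X sc (*) f \<and> (\<exists>C. \<forall>x\<in>X. norm (f x) \<le> C * nrm x) \<and> (\<forall>x. x \<notin> X \<longrightarrow> f x = 0)}"

definition dual_norm :: "('v \<Rightarrow> real) \<Rightarrow> 'v set \<Rightarrow> ('v \<Rightarrow> 'k::real_normed_field) \<Rightarrow> real"
  where "dual_norm nrm X f = (SUP x\<in>{x\<in>X. nrm x \<le> 1}. norm (f x))"

definition annihilator ::
  "('k::real_normed_field \<Rightarrow> 'v::ab_group_add \<Rightarrow> 'v) \<Rightarrow> ('v \<Rightarrow> real) \<Rightarrow> 'v set \<Rightarrow> 'v set \<Rightarrow> ('v \<Rightarrow> 'k) set"
  where "annihilator sc nrm X J = {f \<in> dual sc nrm X. \<forall>y\<in>J. f y = 0}"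

definition pointwise_scale :: "('k \<Rightarrow> 'b \<Rightarrow> 'b) \<Rightarrow> 'k \<Rightarrow> ('a \<Rightarrow> 'b) \<Rightarrow> 'a \<Rightarrow> 'b"
  where "pointwise_scale s c f = (\<lambda>x. s c (f x))"

definition closed_subspace ::
  "('k::field \<Rightarrow> 'v::ab_group_add \<Rightarrow> 'v) \<Rightarrow> ('v \<Rightarrow> real) \<Rightarrow> 'v set \<Rightarrow> 'v set \<Rightarrow> bool"
  where "closed_subspace sc nrm X J \<longleftrightarrow> J \<subseteq> X \<and> module.subspace sc J \<and>
    (\<forall>x\<in>X. (\<forall>e>0. \<exists>y\<in>J. nrm (x - y) < e) \<longrightarrow> x \<in> J)"

definition HB_subspace ::
  "('k::real_normed_field \<Rightarrow> 'v::ab_group_add \<Rightarrow> 'v) \<Rightarrow> ('v \<Rightarrow> real) \<Rightarrow> 'v set \<Rightarrow> 'v set \<Rightarrow> bool"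
  where "HB_subspace sc nrm X J \<longleftrightarrow> closed_subspace sc nrm X J \<and>
    (\<exists>q. q \<in> dual sc nrm X \<rightarrow> dual sc nrm X \<and>
         linear_on_carrier (dual sc nrm X) (pointwise_scale (*)) (pointwise_scale (*)) q \<and>
         (\<forall>f\<in>dual sc nrm X. q (q f) = q f) \<and>
         {f \<in> dual sc nrm X. q f = 0} = annihilator sc nrm X J \<and>
         (\<forall>f\<in>dual sc nrm X. f \<noteq> q f \<longrightarrow>
            dual_norm nrm X (q f) < dual_norm nrm X f \<and>
            dual_norm nrm X (f - q f) \<le> dual_norm nrm X f))"


(* n-tuples are lists of length n; A is unconstrained on lists of other lengths. *)
definition multilinear ::
  "nat \<Rightarrow> ('k::field \<Rightarrow> 'a::ab_group_add \<Rightarrow> 'a) \<Rightarrow> ('k \<Rightarrow> 'b::ab_group_add \<Rightarrow> 'b) \<Rightarrow> ('a list \<Rightarrow> 'b) \<Rightarrow> bool"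
  where "multilinear n sE sF A \<longleftrightarrow>
    (\<forall>xs i. length xs = n \<longrightarrow> i < n \<longrightarrow> Vector_Spaces.linear sE sF (\<lambda>u. A (xs[i := u])))"

definition hom_poly ::
  "nat \<Rightarrow> ('k::field \<Rightarrow> 'a::ab_group_add \<Rightarrow> 'a) \<Rightarrow> ('k \<Rightarrow> 'b::ab_group_add \<Rightarrow> 'b) \<Rightarrow> ('a \<Rightarrow> 'b) \<Rightarrow> bool"
  where "hom_poly n sE sF P \<longleftrightarrow> (\<exists>A. multilinear n sE sF A \<and> (\<forall>x. P x = A (replicate n x)))"

definition polys ::
  "nat \<Rightarrow> ('k::field \<Rightarrow> 'a::real_normed_vector \<Rightarrow> 'a) \<Rightarrow> ('k \<Rightarrow> 'b::real_normed_vector \<Rightarrow> 'b) \<Rightarrow> ('a \<Rightarrow> 'b) set"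
  where "polys n sE sF = {P. hom_poly n sE sF P \<and> continuous_on UNIV P}"

definition poly_norm :: "('a::real_normed_vector \<Rightarrow> 'b::real_normed_vector) \<Rightarrow> real"
  where "poly_norm P = (SUP x\<in>cball 0 1. norm (P x))"

definition weakly_converges ::
  "('k::real_normed_field \<Rightarrow> 'a::real_normed_vector \<Rightarrow> 'a) \<Rightarrow> 'a filter \<Rightarrow> 'a \<Rightarrow> bool"
  where "weakly_converges sE G x \<longleftrightarrow> (\<forall>\<phi>\<in>dual sE norm UNIV. (\<phi> \<longlongrightarrow> \<phi> x) G)"

(* A net is represented by its eventuality filter on 'a; every filter on 'a arises in this way
   (bot is harmless).  The limit of the image net is necessarily P x, as one sees by interleaving
   the net with the constant x. *)
definition weakly_cont_on_bounded ::
  "('k::real_normed_field \<Rightarrow> 'a::real_normed_vector \<Rightarrow> 'a) \<Rightarrow> ('a \<Rightarrow> 'b::real_normed_vector) \<Rightarrow> bool"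
  where "weakly_cont_on_bounded sE P \<longleftrightarrow>
    (\<forall>G x r. eventually (\<lambda>u. norm u \<le> r) G \<longrightarrow> weakly_converges sE G x \<longrightarrow> (P \<longlongrightarrow> P x) G)"

definition polys_w ::
  "nat \<Rightarrow> ('k::real_normed_field \<Rightarrow> 'a::real_normed_vector \<Rightarrow> 'a) \<Rightarrow> ('k \<Rightarrow> 'b::real_normed_vector \<Rightarrow> 'b) \<Rightarrow> ('a \<Rightarrow> 'b) set"
  where "polys_w n sE sF = {P \<in> polys n sE sF. weakly_cont_on_bounded sE P}"

(* The infimum of the empty set is \<infinity>. *)
definition critical_degree :: "('k::real_normed_field \<Rightarrow> 'a::real_normed_vector \<Rightarrow> 'a) \<Rightarrow> enat"
  where "critical_degree sE =
    (INF k\<in>{k. 1 \<le> k \<and> polys_w k sE ((*) :: 'k \<Rightarrow> 'k \<Rightarrow> 'k) \<noteq> polys k sE (*)}. enat k)"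


definition compact_operator ::
  "('k::field \<Rightarrow> 'b::real_normed_vector \<Rightarrow> 'b) \<Rightarrow> ('b \<Rightarrow> 'b) \<Rightarrow> bool"
  where "compact_operator sF T \<longleftrightarrow>
    Vector_Spaces.linear sF sF T \<and> bounded_linear T \<and> compact (closure (T ` cball 0 1))"

definition directed_preorder :: "('i \<Rightarrow> 'i \<Rightarrow> bool) \<Rightarrow> bool"
  where "directed_preorder le \<longleftrightarrow> reflp le \<and> transp le \<and> (\<forall>a b. \<exists>c. le a c \<and> le b c)"

definition net_filter :: "('i \<Rightarrow> 'i \<Rightarrow> bool) \<Rightarrow> 'i filter"
  where "net_filter le = (INF b. principal {c. le b c})"

definition metric_compact_approx_identity ::
  "('k::field \<Rightarrow> 'b::real_normed_vector \<Rightarrow> 'b) \<Rightarrow> ('i \<Rightarrow> 'i \<Rightarrow> bool) \<Rightarrow> ('i \<Rightarrow> 'b \<Rightarrow> 'b) \<Rightarrow> bool"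
  where "metric_compact_approx_identity sF le L \<longleftrightarrow>
    directed_preorder le \<and> (\<forall>\<beta>. compact_operator sF (L \<beta>)) \<and> (\<forall>\<beta>. onorm (L \<beta>) \<le> 1) \<and>
    (\<forall>y. ((\<lambda>\<beta>. L \<beta> y) \<longlongrightarrow> y) (net_filter le))"

end

theory Submission imports Defs begin

text \<open>
  Write \<open>X\<close> for the space of all polynomials, \<open>J\<close> for the weakly continuous ones, and
  \<open>S \<beta> P = L \<beta> \<circ> P\<close>. The projection on the dual of \<open>X\<close> is \<open>q f P = lim f (S \<beta> P)\<close>, the limit
  being taken along a maximal filter that refines the tails of the net.

  Two facts make \<open>q\<close> a projection whose kernel is the annihilator of \<open>J\<close>. First, \<open>S \<beta>\<close> maps \<open>X\<close> into
  \<open>J\<close> (\<open>compact_compose_in_polys_w\<close>): below the critical degree the scalar polynomials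
  \<open>\<phi> \<circ> L \<beta> \<circ> P\<close> are weakly continuous on bounded sets, and on a relatively compact set convergence
  against all functionals is convergence in norm. Hence \<open>q f\<close> depends only on \<open>f\<close> restricted to \<open>J\<close>.
  Second, \<open>S \<beta> P\<close> tends to \<open>P\<close> in norm for \<open>P\<close> in \<open>J\<close> (\<open>S_tendsto_on_J\<close>), because \<open>P\<close> maps the unit
  ball to a totally bounded set (\<open>weakly_cont_image_totally_bounded\<close>), on which the contractions \<open>L \<beta>\<close>
  converge uniformly. Hence \<open>q f\<close> agrees with \<open>f\<close> on \<open>J\<close>.

  Total boundedness rests on the theorem that a polynomial which is weakly continuous on bounded sets is
  weakly uniformly continuous on them (\<open>weakly_cont_imp_uniformly\<close>). The proof given here
  turns a failure of uniformity into nonvanishing differences of arbitrarily high order, which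
  contradicts the finite degree.

  The norm conditions come from the hypotheses on the operators. That \<open>Id - L \<beta>\<close> is a contraction
  bounds \<open>f - q f\<close>. The bound on \<open>L \<beta> y + \<mu> (z - L \<beta> z)\<close> passes to the limit as
  \<open>\<parallel>q f\<parallel> + \<mu> \<parallel>f - q f\<parallel> \<le> (1 + \<epsilon> \<mu>) \<parallel>f\<parallel>\<close> (\<open>dual_norm_sum_bound\<close>), which
  makes \<open>\<parallel>q f\<parallel> < \<parallel>f\<parallel>\<close> once \<open>\<epsilon> \<parallel>f\<parallel> < \<parallel>f - q f\<parallel>\<close>.

  Points of \<open>F\<close> are separated by functionals thanks to the Hahn--Banach theorem, proved by means of minimal
  sublinear functionals.
\<close>

section \<open>The scalar field\<close>

text \<open>
  The scalars are only known up to an isometric field isomorphism with the reals or the complex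
  numbers. What is needed of them is the coordinate form of a scalar, in order to complexify real
  functionals, and the compactness of closed balls.
\<close>
lemma scalar_cases:
  obtains (real) "\<And>c::'k::real_or_complex. \<exists>r. c = of_real r"
  | (complex) j :: "'k::real_or_complex" where "j * j = -1" "norm j = 1" "\<And>c. \<exists>a b. c = of_real a + j * of_real b"
proof -
  obtain \<phi> :: "'k \<Rightarrow> complex" where add: "\<And>x y. \<phi> (x + y) = \<phi> x + \<phi> y"
    and mult: "\<And>x y. \<phi> (x * y) = \<phi> x * \<phi> y" and real: "\<And>r. \<phi> (scaleR r 1) = complex_of_real r"
    and norm: "\<And>x. cmod (\<phi> x) = norm x" and range: "range \<phi> = \<real> \<or> range \<phi> = UNIV"
    using ex_embedding by metis
  have diff: "\<phi> (x - y) = \<phi> x - \<phi> y" for x y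
    using add[of "x - y" y] by (simp add: algebra_simps)
  have inj: "x = y" if "\<phi> x = \<phi> y" for x y
    using norm[of "x - y"] that by (simp add: diff)
  have of_real: "\<phi> (of_real r) = of_real r" for r
    using real[of r] by (simp only: of_real_def[where 'a = 'k])
  from range show thesis
  proof
    assume R: "range \<phi> = \<real>"
    show thesis
    proof (rule that(1))
      fix c :: 'k
      from R have "\<phi> c \<in> \<real>" by blast
      then obtain r where "\<phi> c = of_real r" by (auto elim: Reals_cases)
      then show "\<exists>r. c = of_real r" using inj of_real by metis
    qed
  next
    assume R: "range \<phi> = UNIV"
    obtain j where j: "\<phi> j = \<i>" by (metis R surjD)
    show thesis
    proof (rule that(2))
      have "\<phi> (j * j) = \<phi> (-1)"
        using of_real[of "-1"] by (simp only: mult j of_real_minus of_real_1 i_squared)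
      then show "j * j = -1" by (rule inj)
      show "norm j = 1" using norm[of j] j by simp
      fix c :: 'k
      have "\<phi> (of_real (Re (\<phi> c)) + j * of_real (Im (\<phi> c))) = \<phi> c"
        by (simp only: add mult of_real j complex_eq[symmetric])
      then show "\<exists>a b. c = of_real a + j * of_real b" using inj by metis
    qed
  qed
qed

lemma compact_scalar_cball: "compact (cball (0::'k::real_or_complex) r)"
proof -
  obtain \<phi> :: "'k \<Rightarrow> complex" where add: "\<And>x y. \<phi> (x + y) = \<phi> x + \<phi> y"
    and norm: "\<And>x. cmod (\<phi> x) = norm x" and range: "range \<phi> = \<real> \<or> range \<phi> = UNIV"
    using ex_embedding by metis
  have diff: "\<phi> (x - y) = \<phi> x - \<phi> y" for x y
    using add[of "x - y" y] by (simp add: algebra_simps)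
  have dist: "dist (\<phi> x) (\<phi> y) = dist x y" for x y
    by (metis diff dist_norm norm)
  have inj: "inj \<phi>" by (metis dist dist_eq_0_iff injI)
  have "closed (range \<phi>)" using range closed_complex_Reals by auto
  then have "compact (cball 0 r \<inter> range \<phi>)" by (simp add: compact_Int_closed)
  moreover have "continuous_on (cball 0 r \<inter> range \<phi>) (inv \<phi>)"
    unfolding continuous_on_iff by (metis IntE dist f_inv_into_f)
  ultimately have "compact (inv \<phi> ` (cball 0 r \<inter> range \<phi>))" by (rule compact_continuous_image[rotated])
  moreover have "inv \<phi> ` (cball 0 r \<inter> range \<phi>) = cball 0 r"
  proof (intro equalityI subsetI)
    fix c assume "c \<in> inv \<phi> ` (cball 0 r \<inter> range \<phi>)"
    then obtain d where "\<phi> d \<in> cball 0 r" "c = inv \<phi> (\<phi> d)" by blast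
    then show "c \<in> cball 0 r" using norm by (simp add: inv_f_f[OF inj])
  next
    fix c :: 'k assume "c \<in> cball 0 r"
    then have "\<phi> c \<in> cball 0 r \<inter> range \<phi>" using norm by simp
    then show "c \<in> inv \<phi> ` (cball 0 r \<inter> range \<phi>)" by (metis image_eqI inv_f_f[OF inj])
  qed
  ultimately show ?thesis by simp
qed

section \<open>Hahn--Banach: functionals separate points\<close>

text \<open>
  Total sublinear functionals below the norm, ordered pointwise, replace the partially defined linear
  functionals of the usual proof: a minimal one is automatically linear.
\<close>
definition sublinear_le_norm :: "('b::real_normed_vector \<Rightarrow> real) \<Rightarrow> bool"
  where "sublinear_le_norm p \<longleftrightarrow> (\<forall>x y. p (x + y) \<le> p x + p y) \<and>
    (\<forall>t>0. \<forall>x. p (t *\<^sub>R x) \<le> t * p x) \<and> (\<forall>x. p x \<le> norm x)"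

lemma sublinear_le_normD:
  assumes "sublinear_le_norm p"
  shows "p (x + y) \<le> p x + p y" "p x \<le> norm x" "- p (- x) \<le> p x" "- norm x \<le> p x"
    "p 0 = 0" "t \<ge> 0 \<Longrightarrow> p (t *\<^sub>R x) = t * p x"
proof -
  note p = assms[unfolded sublinear_le_norm_def]
  show "p (x + y) \<le> p x + p y" "p x \<le> norm x" using p by auto
  have "p (0 + 0) \<le> p 0 + p 0" "p 0 \<le> norm (0::'a)" using p by blast+
  then show p0: "p 0 = 0" by simp
  have "p (x + - x) \<le> p x + p (- x)" using p by blast
  then show "- p (- x) \<le> p x" using p0 by simp
  moreover have "p (- x) \<le> norm (- x)" using p by blast
  ultimately show "- norm x \<le> p x" by simp
  show "p (t *\<^sub>R x) = t * p x" if "t \<ge> 0"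
  proof (cases "t = 0")
    case False
    then have t: "t > 0" "inverse t > 0" using that by auto
    have "p (inverse t *\<^sub>R (t *\<^sub>R x)) \<le> inverse t * p (t *\<^sub>R x)" using p t by blast
    then have "t * p x \<le> p (t *\<^sub>R x)" using t by (simp add: field_simps)
    moreover have "p (t *\<^sub>R x) \<le> t * p x" using p t by blast
    ultimately show ?thesis by simp
  qed (simp add: p0)
qed

text \<open>
  The functional \<open>q x = inf {p (x + t a) - t p a | t \<ge> 0}\<close> stays sublinear, and \<open>t = 0\<close> and \<open>t = 1\<close> give
  the two bounds. It is used twice: starting from the norm, it forces the value \<open>norm a\<close> at \<open>a\<close>;
  applied to a minimal \<open>p\<close>, the second bound becomes superadditivity of \<open>p\<close>.
\<close>
lemma sublinear_lower:
  assumes p: "sublinear_le_norm p"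
  obtains q where "sublinear_le_norm q" "\<And>x. q x \<le> p x" "\<And>x. q x \<le> p (x + a) - p a"
proof
  note D = sublinear_le_normD[OF p]
  define q where "q x = (INF t\<in>{0..}. p (x + t *\<^sub>R a) - t * p a)" for x
  have bdd: "bdd_below ((\<lambda>t. p (x + t *\<^sub>R a) - t * p a) ` {0..})" for x
  proof (rule bdd_belowI2)
    fix t :: real assume "t \<in> {0..}"
    then have "t * p a = p (t *\<^sub>R a)" using D(6) by simp
    also have "\<dots> \<le> p (x + t *\<^sub>R a) + p (- x)"
      using D(1)[of "x + t *\<^sub>R a" "- x"] by simp
    finally show "- p (- x) \<le> p (x + t *\<^sub>R a) - t * p a" by simp
  qed
  have le: "q x \<le> p (x + t *\<^sub>R a) - t * p a" if "t \<ge> 0" for x t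
    unfolding q_def by (rule cINF_lower[OF bdd]) (use that in auto)
  have ge: "m \<le> q x" if "\<And>t. t \<ge> 0 \<Longrightarrow> m \<le> p (x + t *\<^sub>R a) - t * p a" for x m
    unfolding q_def by (rule cINF_greatest) (use that in auto)
  show qp: "q x \<le> p x" for x using le[of 0 x] by simp
  show "q x \<le> p (x + a) - p a" for x using le[of 1 x] by simp
  show "sublinear_le_norm q"
    unfolding sublinear_le_norm_def
  proof (intro conjI allI impI)
    fix x y
    have *: "q (x + y) \<le> (p (x + s *\<^sub>R a) - s * p a) + (p (y + t *\<^sub>R a) - t * p a)"
      if "s \<ge> 0" "t \<ge> 0" for s t
    proof -
      have "q (x + y) \<le> p ((x + s *\<^sub>R a) + (y + t *\<^sub>R a)) - (s + t) * p a"
        using le[of "s + t" "x + y"] that by (simp add: algebra_simps)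
      also have "\<dots> \<le> (p (x + s *\<^sub>R a) - s * p a) + (p (y + t *\<^sub>R a) - t * p a)"
        using D(1)[of "x + s *\<^sub>R a" "y + t *\<^sub>R a"] by (simp add: algebra_simps)
      finally show ?thesis .
    qed
    have "q (x + y) - q x \<le> q y"
    proof (rule ge)
      fix t :: real assume t: "t \<ge> 0"
      have "q (x + y) - (p (y + t *\<^sub>R a) - t * p a) \<le> q x"
        by (rule ge) (use *[OF _ t] in \<open>simp add: algebra_simps\<close>)
      then show "q (x + y) - q x \<le> p (y + t *\<^sub>R a) - t * p a" by simp
    qed
    then show "q (x + y) \<le> q x + q y" by simp
  next
    fix s :: real and x assume s: "s > 0"
    have "q (s *\<^sub>R x) / s \<le> q x"
    proof (rule ge)
      fix t :: real assume t: "t \<ge> 0"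
      have "q (s *\<^sub>R x) \<le> p (s *\<^sub>R x + (s * t) *\<^sub>R a) - (s * t) * p a"
        using le[of "s * t" "s *\<^sub>R x"] s t by simp
      also have "s *\<^sub>R x + (s * t) *\<^sub>R a = s *\<^sub>R (x + t *\<^sub>R a)" by (simp add: algebra_simps)
      also have "p (s *\<^sub>R (x + t *\<^sub>R a)) = s * p (x + t *\<^sub>R a)" using D(6) s by simp
      finally show "q (s *\<^sub>R x) / s \<le> p (x + t *\<^sub>R a) - t * p a"
        using s by (simp add: field_simps)
    qed
    then show "q (s *\<^sub>R x) \<le> s * q x" using s by (simp add: field_simps)
  next
    fix x show "q x \<le> norm x" using qp D(2) order_trans by blast
  qed
qed

text \<open>
  Zorn's lemma applies because every sublinear functional below the norm also lies above the negative
  of the norm; so the infimum of a chain is finite, and subadditivity passes to it since any two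
  members of the chain are comparable.
\<close>
lemma ex_minimal_sublinear:
  fixes p0 :: "'b::real_normed_vector \<Rightarrow> real"
  assumes p0: "sublinear_le_norm p0"
  obtains p where "sublinear_le_norm p" "\<And>x. p x \<le> p0 x"
    "\<And>q. sublinear_le_norm q \<Longrightarrow> (\<And>x. q x \<le> p x) \<Longrightarrow> q = p"
proof -
  let ?A = "{p. sublinear_le_norm p \<and> p \<le> p0}"
  let ?R = "\<lambda>p q :: 'b \<Rightarrow> real. q \<le> p"
  have "\<exists>m\<in>?A. \<forall>a\<in>?A. ?R m a \<longrightarrow> a = m"
  proof (rule predicate_Zorn)
    show "partial_order_on ?A (relation_of ?R ?A)"
      by (rule partial_order_on_relation_ofI) auto
  next
    fix C assume C: "C \<in> Chains (relation_of ?R ?A)"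
    then have CA: "C \<subseteq> ?A" unfolding Chains_def relation_of_def by auto
    have tot: "a \<le> b \<or> b \<le> a" if "a \<in> C" "b \<in> C" for a b
      using C that unfolding Chains_def relation_of_def by blast
    show "\<exists>u\<in>?A. \<forall>a\<in>C. ?R a u"
    proof (cases "C = {}")
      case True
      then show ?thesis using p0 by blast
    next
      case False
      define u where "u x = (INF p\<in>C. p x)" for x
      have bdd: "bdd_below ((\<lambda>p. p x) ` C)" for x
        by (rule bdd_belowI2[of _ "- norm x"]) (use CA sublinear_le_normD(4) in blast)
      have le: "u x \<le> p x" if "p \<in> C" for p x
        unfolding u_def by (rule cINF_lower[OF bdd that])
      have ge: "m \<le> u x" if "\<And>p. p \<in> C \<Longrightarrow> m \<le> p x" for m x
        unfolding u_def by (rule cINF_greatest[OF False that])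
      obtain c where c: "c \<in> C" using False by blast
      have "sublinear_le_norm u"
        unfolding sublinear_le_norm_def
      proof (intro conjI allI impI)
        fix x y
        have *: "u (x + y) \<le> p x + q y" if pq: "p \<in> C" "q \<in> C" for p q
        proof -
          obtain r where r: "r \<in> C" "r \<le> p" "r \<le> q" using tot[OF pq] pq by auto
          have "u (x + y) \<le> r (x + y)" using le r by blast
          also have "\<dots> \<le> r x + r y" using sublinear_le_normD(1) r CA by blast
          also have "\<dots> \<le> p x + q y" using r by (simp add: add_mono le_fun_def)
          finally show ?thesis .
        qed
        have "u (x + y) - u x \<le> u y"
        proof (rule ge)
          fix q assume q: "q \<in> C"
          have "u (x + y) - q y \<le> u x" by (rule ge) (use *[OF _ q] in \<open>simp add: algebra_simps\<close>)
          then show "u (x + y) - u x \<le> q y" by simp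
        qed
        then show "u (x + y) \<le> u x + u y" by simp
      next
        fix t :: real and x assume t: "t > 0"
        have "u (t *\<^sub>R x) / t \<le> u x"
        proof (rule ge)
          fix p assume p: "p \<in> C"
          then have "p (t *\<^sub>R x) = t * p x" using sublinear_le_normD(6) CA t by fastforce
          then show "u (t *\<^sub>R x) / t \<le> p x" using le[OF p, of "t *\<^sub>R x"] t by (simp add: field_simps)
        qed
        then show "u (t *\<^sub>R x) \<le> t * u x" using t by (simp add: field_simps)
      next
        fix x show "u x \<le> norm x"
          using le[OF c, of x] sublinear_le_normD(2)[of c x] c CA by auto
      qed
      moreover have "u \<le> p0" using le[OF c] c CA by (auto simp: le_fun_def intro: order_trans)
      ultimately show ?thesis using le by (intro bexI[of _ u]) (auto simp: le_fun_def)
    qed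
  qed
  then obtain m where m: "m \<in> ?A" "\<And>a. a \<in> ?A \<Longrightarrow> a \<le> m \<Longrightarrow> a = m" by blast
  show thesis
  proof (rule that)
    show "sublinear_le_norm m" "\<And>x. m x \<le> p0 x" using m(1) by (auto simp: le_fun_def)
    show "q = m" if "sublinear_le_norm q" "\<And>x. q x \<le> m x" for q
    proof -
      have "q \<le> m" using that(2) by (simp add: le_fun_def)
      moreover have "m \<le> p0" using m(1) by simp
      ultimately show ?thesis using m(2)[of q] that(1) by (auto intro: order_trans)
    qed
  qed
qed

lemma real_Hahn_Banach:
  fixes v :: "'b::real_normed_vector"
  obtains u :: "'b \<Rightarrow> real" where "\<And>x y. u (x + y) = u x + u y" "\<And>t x. u (t *\<^sub>R x) = t * u x"
    "\<And>x. \<bar>u x\<bar> \<le> norm x" "u v = norm v"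
proof -
  have "sublinear_le_norm (norm :: 'b \<Rightarrow> real)"
    by (simp add: sublinear_le_norm_def norm_triangle_ineq)
  then obtain p0 where p0: "sublinear_le_norm p0" "\<And>x. p0 x \<le> norm (x + v) - norm v"
    using sublinear_lower[of norm v] by metis
  obtain p where p: "sublinear_le_norm p" "\<And>x. p x \<le> p0 x"
    "\<And>q. sublinear_le_norm q \<Longrightarrow> (\<And>x. q x \<le> p x) \<Longrightarrow> q = p"
    using ex_minimal_sublinear[OF p0(1)] by metis
  note D = sublinear_le_normD[OF p(1)]
  have add: "p (x + y) = p x + p y" for x y
  proof -
    obtain q where "sublinear_le_norm q" "\<And>x. q x \<le> p x" "\<And>x. q x \<le> p (x + y) - p y"
      using sublinear_lower[OF p(1), of y] by metis
    then have "p x \<le> p (x + y) - p y" using p(3) by metis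
    then show ?thesis using D(1)[of x y] by simp
  qed
  have neg: "p (- x) = - p x" for x using add[of x "- x"] D(5) by simp
  show thesis
  proof (rule that)
    show "p (x + y) = p x + p y" for x y by (fact add)
    show "p (t *\<^sub>R x) = t * p x" for t x
    proof (cases "t \<ge> 0")
      case True then show ?thesis by (rule D(6))
    next
      case False
      then have "p ((- t) *\<^sub>R x) = (- t) * p x" by (intro D(6)) simp
      then show ?thesis using neg[of "t *\<^sub>R x"] by simp
    qed
    show "\<bar>p x\<bar> \<le> norm x" for x using D(2)[of x] D(4)[of x] by simp
    have "p (- v) \<le> - norm v" using p(2)[of "- v"] p0(2)[of "- v"] by simp
    then show "p v = norm v" using neg[of v] D(2)[of v] by simp
  qed
qed

lemma dual_UNIV_iff:
  "f \<in> dual sc nrm UNIV \<longleftrightarrow> (\<forall>x y. f (x + y) = f x + f y) \<and> (\<forall>c x. f (sc c x) = c * f x) \<and>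
     (\<exists>C. \<forall>x. norm (f x) \<le> C * nrm x)"
  by (auto simp: dual_def linear_on_carrier_def)

text \<open>
  Over the complex scalars a real functional \<open>u\<close> is the real part of the complex functional
  \<open>u x - i u (i x)\<close>.
\<close>
lemma dual_separates_points:
  fixes sF :: "'k::real_or_complex \<Rightarrow> 'b::banach \<Rightarrow> 'b"
  assumes "banach_over sF" and v: "v \<noteq> 0"
  obtains \<phi> where "\<phi> \<in> dual sF norm UNIV" "\<phi> v \<noteq> 0"
proof -
  interpret F: banach_over sF by fact
  obtain u :: "'b \<Rightarrow> real" where u: "\<And>x y. u (x + y) = u x + u y" "\<And>t x. u (t *\<^sub>R x) = t * u x"
    "\<And>x. \<bar>u x\<bar> \<le> norm x" "u v = norm v" using real_Hahn_Banach[of v] by metis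
  show thesis
  proof (cases rule: scalar_cases[where 'k = 'k])
    case real
    have hom: "of_real (u (sF c x)) = c * of_real (u x)" for c x
    proof -
      obtain r where "c = of_real r" using real by blast
      then show ?thesis by (simp add: F.scale_of_real u)
    qed
    show thesis
    proof (rule that)
      show "(\<lambda>x. of_real (u x)) \<in> dual sF norm UNIV"
        unfolding dual_UNIV_iff using u(1,3) hom by (auto intro!: exI[of _ 1])
      show "of_real (u v) \<noteq> (0::'k)" using u(4) v by simp
    qed
  next
    case (complex j)
    define \<phi> where "\<phi> x = of_real (u x) - j * of_real (u (sF j x))" for x
    have jj: "sF j (sF j x) = - x" for x
      using complex(1) by simp
    have neg: "u (- x) = - u x" for x using u(2)[of "-1" x] by simp
    have comm: "sF j (t *\<^sub>R x) = t *\<^sub>R sF j x" for t x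
      by (metis F.scale_of_real F.scale_left_commute)
    have hom: "\<phi> (sF c x) = c * \<phi> x" for c x
    proof -
      obtain a b where c: "c = of_real a + j * of_real b" using complex(3) by blast
      have "sF c x = a *\<^sub>R x + b *\<^sub>R sF j x"
      proof -
        have "sF c x = sF (of_real a) x + sF j (sF (of_real b) x)"
          unfolding c by (simp only: F.scale_left_distrib F.scale_scale)
        then show ?thesis by (simp only: F.scale_of_real comm)
      qed
      moreover have "sF j (sF c x) = a *\<^sub>R sF j x - b *\<^sub>R x"
        unfolding calculation by (simp only: F.scale_right_distrib comm jj) simp
      ultimately have u12: "u (sF c x) = a * u x + b * u (sF j x)" "u (sF j (sF c x)) = a * u (sF j x) - b * u x"
        by (simp_all only: u(1,2) neg diff_conv_add_uminus)
      then have "\<phi> (sF c x) = of_real a * of_real (u x) + of_real b * of_real (u (sF j x))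
         - j * of_real a * of_real (u (sF j x)) + j * of_real b * of_real (u x)"
        unfolding \<phi>_def u12 by (simp add: algebra_simps)
      also have "\<dots> = of_real a * of_real (u x) - (j * j) * of_real b * of_real (u (sF j x))
         - j * of_real a * of_real (u (sF j x)) + j * of_real b * of_real (u x)"
        unfolding complex(1) by simp
      also have "\<dots> = c * \<phi> x" unfolding c \<phi>_def by (simp add: algebra_simps)
      finally show ?thesis .
    qed
    have bound: "norm (\<phi> x) \<le> 2 * norm x" for x
    proof -
      have "norm (\<phi> x) \<le> \<bar>u x\<bar> + \<bar>u (sF j x)\<bar>"
        unfolding \<phi>_def by (rule order_trans[OF norm_triangle_ineq4]) (simp add: norm_mult complex(2))
      also have "\<dots> \<le> norm x + norm (sF j x)" by (intro add_mono u(3))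
      finally show ?thesis by (simp add: F.norm_scale complex(2))
    qed
    have "\<phi> v \<noteq> 0"
    proof
      assume "\<phi> v = 0"
      then have e: "of_real (u v) = j * of_real (u (sF j v))" by (simp add: \<phi>_def)
      have "of_real (u v * u v) = (j * of_real (u (sF j v))) * (j * of_real (u (sF j v)))"
        using e by simp
      also have "\<dots> = (j * j) * (of_real (u (sF j v)) * of_real (u (sF j v)))"
        by (simp only: ac_simps)
      also have "\<dots> = of_real (- (u (sF j v) * u (sF j v)))"
        by (simp add: complex(1))
      finally have "u v * u v = - (u (sF j v) * u (sF j v))"
        by (simp only: of_real_eq_iff)
      then have "u v = 0" by (smt (verit) mult_pos_pos not_real_square_gt_zero zero_le_square)
      then show False using u(4) v by simp
    qed
    moreover have "\<phi> \<in> dual sF norm UNIV"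
      unfolding dual_UNIV_iff
    proof (intro conjI allI exI[of _ 2])
      show "\<phi> (x + y) = \<phi> x + \<phi> y" for x y
        by (simp add: \<phi>_def u(1) F.scale_right_distrib algebra_simps)
    qed (fact hom bound)+
    ultimately show thesis using that by blast
  qed
qed

section \<open>Limits along maximal filters\<close>

lemma ex_maximal_filter:
  fixes F :: "'i filter"
  assumes "F \<noteq> bot"
  obtains U where "U \<le> F" "U \<noteq> bot" "\<And>G. G \<le> U \<Longrightarrow> G \<noteq> bot \<Longrightarrow> G = U"
proof -
  let ?A = "{G. G \<le> F \<and> G \<noteq> bot}"
  let ?R = "\<lambda>G H :: 'i filter. H \<le> G"
  have "\<exists>m\<in>?A. \<forall>a\<in>?A. ?R m a \<longrightarrow> a = m"
  proof (rule predicate_Zorn)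
    show "partial_order_on ?A (relation_of ?R ?A)"
      by (rule partial_order_on_relation_ofI) auto
  next
    fix C assume C: "C \<in> Chains (relation_of ?R ?A)"
    then have CA: "C \<subseteq> ?A" unfolding Chains_def relation_of_def by auto
    have tot: "a \<le> b \<or> b \<le> a" if "a \<in> C" "b \<in> C" for a b
      using C that unfolding Chains_def relation_of_def by blast
    show "\<exists>u\<in>?A. \<forall>a\<in>C. ?R a u"
    proof (cases "C = {}")
      case True
      then show ?thesis using assms by blast
    next
      case False
      then obtain c where c: "c \<in> C" by blast
      have "Inf C \<noteq> bot"
        unfolding trivial_limit_def
      proof (subst eventually_Inf_base[OF False])
        show "\<exists>x\<in>C. x \<le> inf G H" if "G \<in> C" "H \<in> C" for G H
          using tot[OF that] that by auto
        show "\<not> (\<exists>b\<in>C. eventually (\<lambda>x. False) b)"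
          using CA by (auto simp: trivial_limit_def)
      qed
      moreover have "Inf C \<le> F" using c CA by (auto intro: Inf_lower2)
      ultimately show ?thesis by (intro bexI[of _ "Inf C"]) (auto intro: Inf_lower)
    qed
  qed
  then obtain m where "m \<in> ?A" "\<And>a. a \<in> ?A \<Longrightarrow> a \<le> m \<Longrightarrow> a = m" by blast
  then show thesis by (intro that[of m]) (auto intro: order_trans)
qed

text \<open>
  A maximal filter is an ultrafilter: refining it by the neighbourhoods of a cluster point of \<open>g\<close>
  cannot make it smaller, so \<open>g\<close> already converges to every cluster point.
\<close>
lemma maximal_filter_limit:
  assumes "U \<noteq> bot" and max: "\<And>G. G \<le> U \<Longrightarrow> G \<noteq> bot \<Longrightarrow> G = U"
    and "compact S" and S: "eventually (\<lambda>i. g i \<in> S) U"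
  obtains l where "(g \<longlongrightarrow> l) U"
proof -
  have "filtermap g U \<noteq> bot" using \<open>U \<noteq> bot\<close> by (simp add: filtermap_bot_iff)
  then obtain l where l: "inf (nhds l) (filtermap g U) \<noteq> bot"
    using \<open>compact S\<close> S unfolding compact_filter by (auto simp: eventually_filtermap)
  let ?G = "inf U (filtercomap g (nhds l))"
  have "?G \<noteq> bot"
  proof
    assume "?G = bot"
    then obtain Q R where Q: "eventually Q U" and R: "eventually R (filtercomap g (nhds l))"
      and QR: "\<And>i. Q i \<Longrightarrow> R i \<Longrightarrow> False" unfolding trivial_limit_def eventually_inf by auto
    obtain R' where R': "eventually R' (nhds l)" "\<And>i. R' (g i) \<Longrightarrow> R i"
      using R unfolding eventually_filtercomap by blast
    have "eventually (\<lambda>i. \<not> R' (g i)) U"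
      using Q by eventually_elim (use QR R' in blast)
    then have "eventually (\<lambda>y. \<not> R' y) (filtermap g U)" by (simp add: eventually_filtermap)
    with R'(1) have "eventually (\<lambda>y. False) (inf (nhds l) (filtermap g U))"
      unfolding eventually_inf by blast
    then show False using l by (simp add: trivial_limit_def)
  qed
  then have "?G = U" by (intro max) simp_all
  then have "U \<le> filtercomap g (nhds l)" by (metis inf.cobounded2)
  then have "(g \<longlongrightarrow> l) U" by (simp add: filterlim_iff_le_filtercomap)
  then show thesis by (rule that)
qed

section \<open>Homogeneous polynomials\<close>

lemma linearD:
  assumes "Vector_Spaces.linear s1 s2 f"
  shows "f (x + y) = f x + f y" "f (s1 c x) = s2 c (f x)" "f 0 = 0" "f (x - y) = f x - f y"
proof -
  interpret Vector_Spaces.linear s1 s2 f by fact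
  show "f (x + y) = f x + f y" "f (s1 c x) = s2 c (f x)" "f 0 = 0" "f (x - y) = f x - f y"
    by (simp_all add: add scale zero diff)
qed

text \<open>The slots of the multilinear form are rescaled one after the other.\<close>
lemma hom_poly_scale:
  assumes P: "hom_poly n sE sF P" and sF: "vector_space sF"
  shows "P (sE c x) = sF (c ^ n) (P x)"
proof -
  interpret F: vector_space sF by fact
  obtain A where A: "multilinear n sE sF A" "\<And>x. P x = A (replicate n x)"
    using P by (auto simp: hom_poly_def)
  have "A (replicate k (sE c x) @ replicate (n - k) x) = sF (c ^ k) (A (replicate n x))" if "k \<le> n" for k
    using that
  proof (induction k)
    case (Suc k)
    let ?xs = "replicate k (sE c x) @ replicate (n - k) x"
    have upd: "?xs[k := u] = replicate k (sE c x) @ u # replicate (n - Suc k) x" for u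
      using Suc.prems by (simp add: list_update_append Suc_diff_Suc[symmetric])
    have lin: "Vector_Spaces.linear sE sF (\<lambda>u. A (?xs[k := u]))"
      using A(1) Suc.prems unfolding multilinear_def by simp
    have "A (?xs[k := sE c x]) = sF c (A (?xs[k := x]))" using linearD(2)[OF lin] .
    moreover have "?xs[k := x] = ?xs"
      using Suc.prems by (intro list_update_same_conv[THEN iffD2]) (auto simp: nth_append)
    moreover have "?xs[k := sE c x] = replicate (Suc k) (sE c x) @ replicate (n - Suc k) x"
      unfolding upd by (simp add: replicate_app_Cons_same)
    ultimately show ?case using Suc by simp
  qed simp
  from this[of n] show ?thesis using A(2) by simp
qed

lemma hom_poly_scaleR:
  fixes sE :: "'k::real_or_complex \<Rightarrow> 'a::banach \<Rightarrow> 'a" and sF :: "'k \<Rightarrow> 'b::banach \<Rightarrow> 'b"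
  assumes "banach_over sE" "banach_over sF" and P: "hom_poly n sE sF P"
  shows "P (r *\<^sub>R x) = r ^ n *\<^sub>R P x"
proof -
  interpret E: banach_over sE by fact
  interpret F: banach_over sF by fact
  have "P (sE (of_real r) x) = sF (of_real (r ^ n)) (P x)"
    using hom_poly_scale[OF P F.vector_space_axioms] by simp
  then show ?thesis by (simp only: E.scale_of_real F.scale_of_real)
qed

lemma hom_poly_add:
  assumes P: "hom_poly n sE sF P" and Q: "hom_poly n sE sF Q"
  shows "hom_poly n sE sF (\<lambda>x. P x + Q x)"
proof -
  obtain A B where A: "multilinear n sE sF A" "\<And>x. P x = A (replicate n x)"
    and B: "multilinear n sE sF B" "\<And>x. Q x = B (replicate n x)"
    using P Q by (auto simp: hom_poly_def)
  have "multilinear n sE sF (\<lambda>xs. A xs + B xs)"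
    unfolding multilinear_def
  proof (intro allI impI)
    fix xs :: "'b list" and i assume *: "length xs = n" "i < n"
    have la: "Vector_Spaces.linear sE sF (\<lambda>u. A (xs[i := u]))"
      and lb: "Vector_Spaces.linear sE sF (\<lambda>u. B (xs[i := u]))"
      using A(1) B(1) * by (auto simp: multilinear_def)
    interpret a: Vector_Spaces.linear sE sF "\<lambda>u. A (xs[i := u])" by (fact la)
    show "Vector_Spaces.linear sE sF (\<lambda>u. A (xs[i := u]) + B (xs[i := u]))"
      using la lb unfolding Vector_Spaces.linear_iff
      by (simp add: a.vs2.scale_right_distrib algebra_simps)
  qed
  then show ?thesis
    unfolding hom_poly_def by (intro exI[of _ "\<lambda>xs. A xs + B xs"]) (simp add: A(2) B(2))
qed

lemma hom_poly_compose_linear: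
  assumes P: "hom_poly n sE sF P" and T: "Vector_Spaces.linear sF sG T"
  shows "hom_poly n sE sG (\<lambda>x. T (P x))"
proof -
  obtain A where A: "multilinear n sE sF A" "\<And>x. P x = A (replicate n x)"
    using P by (auto simp: hom_poly_def)
  have "multilinear n sE sG (\<lambda>xs. T (A xs))"
    using A(1) T unfolding multilinear_def Vector_Spaces.linear_iff by simp
  then show ?thesis
    unfolding hom_poly_def by (intro exI[of _ "\<lambda>xs. T (A xs)"]) (simp add: A(2))
qed

text \<open>
  The degree is measured by iterated differences: every difference of order \<open>m + 1\<close> vanishes. This
  makes sense for arbitrary functions, so that the multilinear forms can be forgotten afterwards.
\<close>
primrec degree_le :: "nat \<Rightarrow> ('a::ab_group_add \<Rightarrow> 'b::ab_group_add) \<Rightarrow> bool"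
  where "degree_le 0 f \<longleftrightarrow> (\<forall>x z. f (x + z) - f x = 0)"
  | "degree_le (Suc m) f \<longleftrightarrow> (\<forall>z. degree_le m (\<lambda>x. f (x + z) - f x))"

lemma degree_le_zero: "degree_le m (\<lambda>x. 0)"
  by (induction m) simp_all

lemma degree_le_add: "degree_le m f \<Longrightarrow> degree_le m g \<Longrightarrow> degree_le m (\<lambda>x. f x + g x)"
proof (induction m arbitrary: f g)
  case 0
  then show ?case by simp
next
  case (Suc m)
  have "degree_le m (\<lambda>x. (f (x + z) - f x) + (g (x + z) - g x))" for z
    using Suc by simp
  then show ?case by (simp add: algebra_simps)
qed

lemma degree_le_sum: "(\<And>i. i \<in> I \<Longrightarrow> degree_le m (f i)) \<Longrightarrow> degree_le m (\<lambda>x. \<Sum>i\<in>I. f i x)"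
  by (induction I rule: infinite_finite_induct) (simp_all add: degree_le_zero degree_le_add)

text \<open>
  The induction needs forms in which each slot is either a translate of the variable or constant; \<open>S\<close>
  is the set of slots of the first kind. Taking a difference, a telescoping sum that changes one slot
  at a time turns one variable slot into the constant \<open>z\<close> in every summand, and lowers \<open>card S\<close>.
\<close>
lemma multilinear_degree_le:
  assumes A: "multilinear n sE sF A"
  shows "S \<subseteq> {..<n} \<Longrightarrow> card S = m \<Longrightarrow> (\<And>j. j \<in> S \<Longrightarrow> \<exists>c. \<forall>x. g j x = x + c) \<Longrightarrow>
    (\<And>j x y. j < n \<Longrightarrow> j \<notin> S \<Longrightarrow> g j x = g j y) \<Longrightarrow> degree_le m (\<lambda>x. A (map (\<lambda>j. g j x) [0..<n]))"
proof (induction m arbitrary: S g)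
  case 0
  then have "S = {}" using finite_subset by fastforce
  then have eq: "map (\<lambda>j. g j x) [0..<n] = map (\<lambda>j. g j y) [0..<n]" for x y
    using 0(4) by auto
  show ?case unfolding degree_le.simps by (metis eq diff_self)
next
  case (Suc m)
  have fin: "finite S" using Suc.prems(1) finite_subset by blast
  show ?case
    unfolding degree_le.simps
  proof
    fix z
    \<comment> \<open>\<open>?T i x\<close> has its first \<open>i\<close> slots evaluated at \<open>x + z\<close> already; \<open>?g i\<close> are the slots of the
      difference of two consecutive such terms.\<close>
    let ?T = "\<lambda>i x. map (\<lambda>j. if j < i then g j (x + z) else g j x) [0..<n]"
    let ?g = "\<lambda>i j x. if j < i then g j (x + z) else if j = i then z else g j x"
    have upd: "map (\<lambda>j. if j < i then g j (x + z) else if j = i then u else g j x) [0..<n] = (?T i x)[i := u]" for i u x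
      by (auto intro!: nth_equalityI simp: nth_list_update)
    have step: "A (?T (Suc i) x) - A (?T i x) = (if i \<in> S then A (map (\<lambda>j. ?g i j x) [0..<n]) else 0)"
      if i: "i < n" for i x
    proof -
      have lin: "Vector_Spaces.linear sE sF (\<lambda>u. A ((?T i x)[i := u]))"
        using A i unfolding multilinear_def by simp
      have 1: "?T (Suc i) x = (?T i x)[i := g i (x + z)]"
        unfolding upd[symmetric] by (auto simp: less_Suc_eq)
      have 2: "?T i x = (?T i x)[i := g i x]"
        unfolding upd[symmetric] by auto
      show ?thesis
      proof (cases "i \<in> S")
        case True
        then obtain c where c: "\<And>x. g i x = x + c" using Suc.prems(3) by blast
        have "A (?T (Suc i) x) - A (?T i x) = A ((?T i x)[i := g i (x + z)]) - A ((?T i x)[i := g i x])"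
          by (simp only: 1 2[symmetric])
        also have "\<dots> = A ((?T i x)[i := g i (x + z) - g i x])" using linearD(4)[OF lin] by simp
        also have "g i (x + z) - g i x = z" using c by simp
        finally show ?thesis using True by (simp only: upd if_True)
      next
        case False
        then have "g i (x + z) = g i x" using Suc.prems(4) i by blast
        then have "A (?T (Suc i) x) = A (?T i x)" by (simp only: 1 2[symmetric])
        then show ?thesis using False by (simp only: diff_self if_False)
      qed
    qed
    have "A (map (\<lambda>j. g j (x + z)) [0..<n]) - A (map (\<lambda>j. g j x) [0..<n])
        = (\<Sum>i\<in>S. A (map (\<lambda>j. ?g i j x) [0..<n]))" for x
    proof -
      have n: "?T n x = map (\<lambda>j. g j (x + z)) [0..<n]" by auto
      have "A (?T n x) - A (?T 0 x) = (\<Sum>i<n. A (?T (Suc i) x) - A (?T i x))"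
        by (rule sum_lessThan_telescope[symmetric])
      also have "\<dots> = (\<Sum>i<n. if i \<in> S then A (map (\<lambda>j. ?g i j x) [0..<n]) else 0)"
        by (rule sum.cong) (use step in auto)
      also have "\<dots> = (\<Sum>i\<in>S. A (map (\<lambda>j. ?g i j x) [0..<n]))"
        using Suc.prems(1) by (subst sum.inter_restrict[symmetric]) (auto simp: Int_absorb1)
      finally show ?thesis unfolding n by simp
    qed
    moreover have "degree_le m (\<lambda>x. \<Sum>i\<in>S. A (map (\<lambda>j. ?g i j x) [0..<n]))"
    proof (rule degree_le_sum, rule Suc.IH)
      fix i assume i: "i \<in> S"
      show "S - {i} \<subseteq> {..<n}" using Suc.prems(1) by blast
      show "card (S - {i}) = m" using Suc.prems(2) i fin by simp
      show "\<exists>c. \<forall>x. ?g i j x = x + c" if "j \<in> S - {i}" for j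
      proof -
        obtain c where "\<And>x. g j x = x + c" using Suc.prems(3) \<open>j \<in> S - {i}\<close> by blast
        then show ?thesis using that
          by (cases "j < i") (auto simp: add.assoc intro: exI[of _ "z + c"] exI[of _ c])
      qed
      show "?g i j x = ?g i j y" if "j < n" "j \<notin> S - {i}" for j x y
        using Suc.prems(4)[of j] that by (cases "j = i") auto
    qed
    ultimately show "degree_le m (\<lambda>x. A (map (\<lambda>j. g j (x + z)) [0..<n]) - A (map (\<lambda>j. g j x) [0..<n]))"
      by simp
  qed
qed

lemma hom_poly_degree_le:
  assumes "hom_poly n sE sF P"
  shows "degree_le n P"
proof -
  obtain A where A: "multilinear n sE sF A" "\<And>x. P x = A (replicate n x)"
    using assms by (auto simp: hom_poly_def)
  have "degree_le n (\<lambda>x. A (map (\<lambda>j. x) [0..<n]))"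
    by (rule multilinear_degree_le[OF A(1), of "{..<n}" n "\<lambda>j x. x"]) (auto intro: exI[of _ 0])
  moreover have "P = (\<lambda>x. A (map (\<lambda>j. x) [0..<n]))" using A(2) by (simp add: fun_eq_iff map_replicate_const)
  ultimately show ?thesis by simp
qed

text \<open>
  The head of the list is the outermost difference, so that the differences for the same steps at two
  points combine into one of the next order.
\<close>
primrec diffs :: "'a::ab_group_add list \<Rightarrow> ('a \<Rightarrow> 'b::ab_group_add) \<Rightarrow> 'a \<Rightarrow> 'b"
  where "diffs [] f x = f x"
  | "diffs (z # zs) f x = diffs zs f (x + z) - diffs zs f x"

lemma diffs_difference: "diffs zs (\<lambda>x. f (x + z) - f x) x = diffs zs f (x + z) - diffs zs f x"
proof (induction zs arbitrary: x)
  case (Cons a zs)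
  show ?case unfolding diffs.simps Cons.IH by (simp add: ac_simps)
qed simp

lemma degree_le_diffs: "degree_le m f \<Longrightarrow> length zs = Suc m \<Longrightarrow> diffs zs f x = 0"
proof (induction m arbitrary: f zs)
  case 0
  then show ?case by (cases zs) auto
next
  case (Suc m)
  then obtain z zs' where zs: "zs = z # zs'" "length zs' = Suc m" by (cases zs) auto
  have "diffs zs' (\<lambda>x. f (x + z) - f x) x = 0"
    using Suc.IH[OF _ zs(2)] Suc.prems(1) by simp
  then show ?case unfolding zs by (simp add: diffs_difference)
qed

section \<open>The normed space of polynomials\<close>

text \<open>\<open>n \<ge> 1\<close> makes every polynomial vanish at \<open>0\<close>, hence bounded on the unit ball by continuity there.\<close>
locale polynomials = E: banach_over sE + F: banach_over sF
  for sE :: "'k::real_or_complex \<Rightarrow> 'a::banach \<Rightarrow> 'a" and sF :: "'k \<Rightarrow> 'b::banach \<Rightarrow> 'b" +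
  fixes n :: nat
  assumes n: "1 \<le> n"
begin

abbreviation "X \<equiv> polys n sE sF"
abbreviation "J \<equiv> polys_w n sE sF"
abbreviation "nrm \<equiv> (poly_norm :: ('a \<Rightarrow> 'b) \<Rightarrow> real)"

lemma poly_scaleR: "P \<in> X \<Longrightarrow> P (r *\<^sub>R x) = r ^ n *\<^sub>R P x"
  using hom_poly_scaleR[OF E.banach_over_axioms F.banach_over_axioms] by (simp add: polys_def)

lemma poly_bdd_on_ball:
  assumes P: "P \<in> X"
  obtains C where "\<And>x. norm x \<le> 1 \<Longrightarrow> norm (P x) \<le> C"
proof -
  have P0: "P 0 = 0" using poly_scaleR[OF P, of 0 0] n by (simp add: power_0_left)
  have "isCont P 0" using P by (simp add: polys_def continuous_on_eq_continuous_at)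
  then obtain d where d: "d > 0" "\<And>x. norm x < d \<Longrightarrow> norm (P x) < 1"
  proof -
    obtain d where "d > 0" "\<forall>x. dist x 0 < d \<longrightarrow> dist (P x) (P 0) < 1"
      using \<open>isCont P 0\<close>[unfolded continuous_at_eps_delta, rule_format, of 1] by auto
    then show thesis by (intro that) (auto simp: P0 dist_norm)
  qed
  show thesis
  proof (rule that)
    fix x :: 'a assume x: "norm x \<le> 1"
    have "d/2 * norm x \<le> d/2 * 1" using x d(1) by (intro mult_left_mono) auto
    then have "norm ((d/2) *\<^sub>R x) < d" using d(1) by simp
    then have "norm (P ((d/2) *\<^sub>R x)) < 1" by (rule d(2))
    then have "(d/2) ^ n * norm (P x) < 1" using d(1) by (simp add: poly_scaleR[OF P])
    then show "norm (P x) \<le> 1 / (d/2) ^ n" using d(1) by (simp add: field_simps)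
  qed
qed

lemma poly_norm_bdd: "P \<in> X \<Longrightarrow> bdd_above ((\<lambda>x. norm (P x)) ` cball 0 1)"
  by (rule poly_bdd_on_ball) (auto intro!: bdd_aboveI2)

lemma norm_le_poly_norm: "P \<in> X \<Longrightarrow> norm x \<le> 1 \<Longrightarrow> norm (P x) \<le> nrm P"
  unfolding poly_norm_def by (rule cSUP_upper[OF _ poly_norm_bdd]) auto

lemma poly_norm_le: "(\<And>x. norm x \<le> 1 \<Longrightarrow> norm (P x) \<le> C) \<Longrightarrow> nrm P \<le> C"
  unfolding poly_norm_def by (rule cSUP_least) auto

lemma poly_norm_nonneg: "P \<in> X \<Longrightarrow> 0 \<le> nrm P"
  using norm_le_poly_norm[of P 0] by (metis norm_ge_zero norm_zero order_trans zero_le_one)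

lemma norm_le_on_bounded:
  assumes P: "P \<in> X" and "norm x \<le> r" "0 < r"
  shows "norm (P x) \<le> r ^ n * nrm P"
proof -
  have "norm (inverse r *\<^sub>R x) \<le> 1" using assms by (simp add: field_simps)
  then have "norm (P (inverse r *\<^sub>R x)) \<le> nrm P" by (rule norm_le_poly_norm[OF P])
  then show ?thesis using assms by (simp add: poly_scaleR[OF P] field_simps)
qed

lemma linear_scaleF: "Vector_Spaces.linear sF sF (sF c)"
  unfolding Vector_Spaces.linear_iff using F.vector_space_axioms
  by (simp add: F.scale_right_distrib mult.commute)

lemma continuous_scaleF: "continuous_on UNIV (sF c)"
proof -
  have "bounded_linear (sF c)"
  proof (rule bounded_linear_intro[where K = "norm c"])
    show "sF c (r *\<^sub>R x) = r *\<^sub>R sF c x" for r x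
      by (metis F.scale_of_real F.scale_left_commute)
  qed (simp_all add: F.scale_right_distrib F.norm_scale mult.commute)
  then show ?thesis by (rule bounded_linear.continuous_on) (rule continuous_on_id)
qed

lemma polys_compose:
  assumes "P \<in> X" "Vector_Spaces.linear sF sG T" "continuous_on UNIV T"
  shows "(\<lambda>x. T (P x)) \<in> polys n sE sG"
proof -
  have P: "hom_poly n sE sF P" "continuous_on UNIV P" using assms(1) by (simp_all add: polys_def)
  have "continuous_on UNIV (\<lambda>x. T (P x))"
    by (rule continuous_on_compose2[OF assms(3) P(2)]) simp
  then show ?thesis using hom_poly_compose_linear[OF P(1) assms(2)] by (simp add: polys_def)
qed

lemma polys_add: assumes "P \<in> X" "Q \<in> X" shows "P + Q \<in> X"
proof -
  have P: "hom_poly n sE sF P" "continuous_on UNIV P" and Q: "hom_poly n sE sF Q" "continuous_on UNIV Q"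
    using assms by (simp_all add: polys_def)
  have "(\<lambda>x. P x + Q x) \<in> X"
    unfolding polys_def using hom_poly_add[OF P(1) Q(1)] continuous_on_add[OF P(2) Q(2)] by blast
  moreover have "P + Q = (\<lambda>x. P x + Q x)" by (rule ext) (rule plus_fun_apply)
  ultimately show ?thesis by (simp only:)
qed

lemma polys_scale: "P \<in> X \<Longrightarrow> pointwise_scale sF c P \<in> X"
  unfolding pointwise_scale_def using polys_compose[of P sF "sF c"] linear_scaleF continuous_scaleF by blast

lemma polys_diff: assumes "P \<in> X" "Q \<in> X" shows "P - Q \<in> X"
proof -
  have "P - Q = P + pointwise_scale sF (-1) Q"
    by (rule ext) (simp only: minus_apply plus_fun_apply pointwise_scale_def F.scale_minus_left F.scale_one
        add_uminus_conv_diff)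
  also have "\<dots> \<in> X" by (intro polys_add polys_scale assms)
  finally show ?thesis .
qed

lemma weakly_cont_add:
  "weakly_cont_on_bounded sE P \<Longrightarrow> weakly_cont_on_bounded sE Q \<Longrightarrow>
   weakly_cont_on_bounded sE (P + Q :: 'a \<Rightarrow> 'b)"
  unfolding weakly_cont_on_bounded_def plus_fun_def by (blast intro: tendsto_add)

lemma weakly_cont_compose:
  fixes P :: "'a \<Rightarrow> 'b"
  assumes "weakly_cont_on_bounded sE P" "continuous_on UNIV T"
  shows "weakly_cont_on_bounded sE (\<lambda>x. T (P x))"
proof -
  have "isCont T y" for y using assms(2) by (simp add: continuous_on_eq_continuous_at)
  then show ?thesis using assms(1) unfolding weakly_cont_on_bounded_def
    by (metis isCont_tendsto_compose)
qed

lemma zero_in_polys_w: "0 \<in> J"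
proof -
  have "multilinear n sE sF (\<lambda>_. 0)"
    unfolding multilinear_def Vector_Spaces.linear_iff
    using E.vector_space_axioms F.vector_space_axioms by simp
  then have "hom_poly n sE sF (\<lambda>_. 0)" unfolding hom_poly_def by auto
  then show ?thesis by (simp add: polys_w_def polys_def weakly_cont_on_bounded_def zero_fun_def)
qed

lemma module_pointwise_scale: "module (pointwise_scale sF :: 'k \<Rightarrow> ('a \<Rightarrow> 'b) \<Rightarrow> _)"
  by standard (rule ext, simp only: pointwise_scale_def plus_fun_apply F.scale_right_distrib
      F.scale_left_distrib F.scale_scale F.scale_one)+

text \<open>A limit in norm is uniform on every bounded set, by homogeneity.\<close>
lemma weakly_cont_closed:
  assumes P: "P \<in> X" and ap: "\<And>e. e > 0 \<Longrightarrow> \<exists>Q\<in>J. nrm (P - Q) < e"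
  shows "weakly_cont_on_bounded sE P"
  unfolding weakly_cont_on_bounded_def
proof (intro allI impI)
  fix G :: "'a filter" and x r
  assume G: "eventually (\<lambda>u. norm u \<le> r) G" "weakly_converges sE G x"
  define R where "R = max (max r (norm x)) 1"
  have R: "R > 0" "norm x \<le> R" "r \<le> R" by (auto simp: R_def)
  show "(P \<longlongrightarrow> P x) G"
  proof (rule tendstoI)
    fix e :: real assume e: "e > 0"
    have "e / (3 * R ^ n) > 0" using e R by simp
    then obtain Q where Q: "Q \<in> J" "nrm (P - Q) < e / (3 * R ^ n)" using ap by blast
    then have QX: "Q \<in> X" by (simp add: polys_w_def)
    have near: "norm (P u - Q u) < e / 3" if "norm u \<le> R" for u
    proof -
      have "norm ((P - Q) u) \<le> R ^ n * nrm (P - Q)"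
        by (rule norm_le_on_bounded[OF polys_diff[OF P QX] that R(1)])
      also have "\<dots> < R ^ n * (e / (3 * R ^ n))"
          by (rule mult_strict_left_mono[OF Q(2)]) (simp add: R(1))
      also have "\<dots> = e / 3" using R(1) by simp
      finally show ?thesis by simp
    qed
    have "(Q \<longlongrightarrow> Q x) G" using Q(1) G unfolding polys_w_def weakly_cont_on_bounded_def by blast
    then have "eventually (\<lambda>u. dist (Q u) (Q x) < e / 3) G" using e by (intro tendstoD) auto
    with G(1) show "eventually (\<lambda>u. dist (P u) (P x) < e) G"
    proof eventually_elim
      case (elim u)
      have "norm (P u - P x) \<le> norm (P u - Q u) + norm (Q u - Q x) + norm (P x - Q x)"
        by norm
      moreover have "norm (P u - Q u) < e / 3" "norm (P x - Q x) < e / 3"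
        using near R elim by auto
      ultimately show ?case using elim(2) by (simp add: dist_norm)
    qed
  qed
qed

lemma closed_subspace_polys_w: "closed_subspace (pointwise_scale sF) nrm X J"
  unfolding closed_subspace_def module.subspace_def[OF module_pointwise_scale]
proof (intro conjI allI ballI impI)
  show JX: "J \<subseteq> X" by (auto simp: polys_w_def)
  show "0 \<in> J" by (rule zero_in_polys_w)
  show "P + Q \<in> J" if "P \<in> J" "Q \<in> J" for P Q
    using that polys_add weakly_cont_add unfolding polys_w_def by blast
  show "pointwise_scale sF c P \<in> J" if "P \<in> J" for c P
    using that polys_scale[of P c] weakly_cont_compose[of P "sF c"] continuous_scaleF
    unfolding polys_w_def pointwise_scale_def by blast
  show "P \<in> J" if "P \<in> X" "\<forall>e>0. \<exists>Q\<in>J. nrm (P - Q) < e" for P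
    using that weakly_cont_closed unfolding polys_w_def by blast
qed

end

section \<open>Weakly continuous polynomials map the ball to a totally bounded set\<close>

lemma dual_UNIV_D:
  assumes "\<phi> \<in> dual sc nrm UNIV"
  shows "\<phi> (x + y) = \<phi> x + \<phi> y" "\<phi> (sc c x) = c * \<phi> x" "\<phi> 0 = 0" "\<phi> (- x) = - \<phi> x"
    "\<phi> (x - y) = \<phi> x - \<phi> y" "\<exists>C. \<forall>x. norm (\<phi> x) \<le> C * nrm x"
proof -
  have *: "(\<forall>x y. \<phi> (x + y) = \<phi> x + \<phi> y) \<and> (\<forall>c x. \<phi> (sc c x) = c * \<phi> x) \<and>
     (\<exists>C. \<forall>x. norm (\<phi> x) \<le> C * nrm x)"
    using assms unfolding dual_UNIV_iff .
  then show add: "\<phi> (x + y) = \<phi> x + \<phi> y" and "\<phi> (sc c x) = c * \<phi> x"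
    and "\<exists>C. \<forall>x. norm (\<phi> x) \<le> C * nrm x" for x y by blast+
  show z: "\<phi> 0 = 0" using add[of 0 0] by simp
  show m: "\<phi> (- x) = - \<phi> x" for x using add[of x "- x"] z by (simp add: add_eq_0_iff)
  show "\<phi> (x - y) = \<phi> x - \<phi> y" using add[of x "- y"] m[of y] by simp
qed

text \<open>Basic neighbourhoods of zero in the weak topology, for finite sets of functionals.\<close>
definition weakly_small :: "('a \<Rightarrow> 'k::real_normed_vector) set \<Rightarrow> real \<Rightarrow> 'a \<Rightarrow> bool"
  where "weakly_small \<Phi> \<delta> z \<longleftrightarrow> (\<forall>\<phi>\<in>\<Phi>. norm (\<phi> z) \<le> \<delta>)"

lemma weakly_small_mono:
  "weakly_small \<Phi> \<delta> z \<Longrightarrow> \<Psi> \<subseteq> \<Phi> \<Longrightarrow> \<delta> \<le> \<delta>' \<Longrightarrow> weakly_small \<Psi> \<delta>' z"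
  unfolding weakly_small_def by (meson order_trans subsetD)

text \<open>
  Weak continuity is stated for filters; here it is applied to the filter of weak neighbourhoods of \<open>x\<close>
  in a ball.
\<close>
lemma weakly_cont_neighbourhood:
  fixes P :: "'a::real_normed_vector \<Rightarrow> 'b::real_normed_vector"
    and sE :: "'k::real_normed_field \<Rightarrow> 'a \<Rightarrow> 'a"
  assumes P: "weakly_cont_on_bounded sE P" and e: "e > 0"
  obtains \<Phi> \<delta> where "finite \<Phi>" "\<Phi> \<subseteq> dual sE norm UNIV" "\<delta> > 0"
    "\<And>u. norm u \<le> r \<Longrightarrow> weakly_small \<Phi> \<delta> (u - x) \<Longrightarrow> norm (P u - P x) < e"
proof -
  define I :: "(('a \<Rightarrow> 'k) set \<times> real) set" where "I = {(\<Phi>, \<delta>). finite \<Phi> \<and> \<Phi> \<subseteq> dual sE norm UNIV \<and> \<delta> > 0}"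
  define V :: "('a \<Rightarrow> 'k) set \<times> real \<Rightarrow> 'a set" where "V = (\<lambda>(\<Phi>, \<delta>). {u. norm u \<le> r \<and> weakly_small \<Phi> \<delta> (u - x)})"
  define G where "G = (INF i\<in>I. principal (V i))"
  have I: "({}, 1) \<in> I" by (simp add: I_def)
  have base: "eventually Q G \<longleftrightarrow> (\<exists>i\<in>I. \<forall>u\<in>V i. Q u)" for Q
  proof -
    have "eventually Q G \<longleftrightarrow> (\<exists>i\<in>I. eventually Q (principal (V i)))"
      unfolding G_def
    proof (rule eventually_INF_base)
      show "I \<noteq> {}" using I by blast
      fix i j assume ij: "i \<in> I" "j \<in> I"
      obtain \<Phi> \<delta> \<Psi> \<eta> where [simp]: "i = (\<Phi>, \<delta>)" "j = (\<Psi>, \<eta>)" by (metis surj_pair)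
      have "(\<Phi> \<union> \<Psi>, min \<delta> \<eta>) \<in> I" using ij by (simp add: I_def)
      moreover have "V (\<Phi> \<union> \<Psi>, min \<delta> \<eta>) \<subseteq> V i \<inter> V j"
        by (auto simp: V_def elim: weakly_small_mono)
      ultimately show "\<exists>k\<in>I. principal (V k) \<le> inf (principal (V i)) (principal (V j))"
        by (metis inf_principal principal_le_iff)
    qed
    then show ?thesis by (simp add: eventually_principal)
  qed
  have "eventually (\<lambda>u. norm u \<le> r) G"
    unfolding base by (rule bexI[OF _ I]) (simp add: V_def)
  moreover have "weakly_converges sE G x"
    unfolding weakly_converges_def
  proof (intro ballI tendstoI)
    fix \<phi> and e :: real assume \<phi>: "\<phi> \<in> dual sE norm UNIV" and "e > 0"
    then have i: "({\<phi>}, e / 2) \<in> I" by (simp add: I_def)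
    show "eventually (\<lambda>u. dist (\<phi> u) (\<phi> x) < e) G"
      unfolding base
    proof (rule bexI[OF _ i], rule ballI)
      fix u assume "u \<in> V ({\<phi>}, e / 2)"
      then have "norm (\<phi> (u - x)) \<le> e / 2" by (simp add: V_def weakly_small_def)
      then have "norm (\<phi> u - \<phi> x) < e" using dual_UNIV_D(5)[OF \<phi>, of u x] \<open>e > 0\<close> by simp
      then show "dist (\<phi> u) (\<phi> x) < e" by (simp add: dist_norm)
    qed
  qed
  ultimately have "(P \<longlongrightarrow> P x) G" using P unfolding weakly_cont_on_bounded_def by blast
  then have "eventually (\<lambda>u. dist (P u) (P x) < e) G" using e by (rule tendstoD)
  then obtain i where "i \<in> I" "\<forall>u\<in>V i. dist (P u) (P x) < e" unfolding base by blast
  then show thesis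
    by (intro that[of "fst i" "snd i"]) (auto simp: I_def V_def dist_norm)
qed

text \<open>
  A difference of positive order at a fixed point is an alternating sum of values of \<open>P\<close> near that
  point, with as many plus as minus signs; so weakly small steps make it small.
\<close>
lemma diffs_weakly_small:
  fixes P :: "'a::real_normed_vector \<Rightarrow> 'b::real_normed_vector"
    and sE :: "'k::real_normed_field \<Rightarrow> 'a \<Rightarrow> 'a"
  assumes P: "weakly_cont_on_bounded sE P" and e: "e > 0"
  obtains \<Phi> \<delta> where "finite \<Phi>" "\<Phi> \<subseteq> dual sE norm UNIV" "\<delta> > 0"
    "\<And>zs. length zs = Suc k \<Longrightarrow> (\<And>z. z \<in> set zs \<Longrightarrow> norm z \<le> 2 \<and> weakly_small \<Phi> \<delta> z) \<Longrightarrow>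
       norm (diffs zs P y) < e"
proof -
  define K where "K = Suc k"
  define e' where "e' = e / 2 ^ K"
  have e': "e' > 0" using e by (simp add: e'_def)
  obtain \<Phi> \<delta>' where \<Phi>: "finite \<Phi>" "\<Phi> \<subseteq> dual sE norm UNIV" and \<delta>': "\<delta>' > 0"
    and near: "\<And>u. norm u \<le> norm y + 2 * K \<Longrightarrow> weakly_small \<Phi> \<delta>' (u - y) \<Longrightarrow> norm (P u - P y) < e'"
    using weakly_cont_neighbourhood[OF P e', of "norm y + 2 * K" y] by metis
  define \<delta> where "\<delta> = \<delta>' / K"
  have \<delta>: "\<delta> > 0" using \<delta>' by (simp add: \<delta>_def K_def)
  \<comment> \<open>The base point drifts to \<open>y + u\<close>; \<open>m\<close> counts the steps it has already absorbed. A difference of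
    order zero is near \<open>P y\<close>, and one further difference cancels this term.\<close>
  have bound: "norm (diffs zs P (y + u) - (if zs = [] then P y else 0)) < 2 ^ length zs * e'"
    if "norm u \<le> 2 * m" "weakly_small \<Phi> (m * \<delta>) u" "m + length zs \<le> K"
      "\<And>z. z \<in> set zs \<Longrightarrow> norm z \<le> 2 \<and> weakly_small \<Phi> \<delta> z" for zs u and m :: nat
    using that
  proof (induction zs arbitrary: u m)
    case Nil
    have mK: "real m \<le> real K" using Nil by simp
    have "norm (y + u) \<le> norm y + 2 * K"
      using Nil(1) mK norm_triangle_ineq[of y u] by linarith
    moreover have "m * \<delta> \<le> \<delta>'"
    proof -
      have "m * \<delta> \<le> K * \<delta>" using mK \<delta> by (intro mult_right_mono) auto
      also have "K * \<delta> = \<delta>'" by (simp add: \<delta>_def K_def)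
      finally show ?thesis .
    qed
    then have "weakly_small \<Phi> \<delta>' (y + u - y)"
      using Nil(2) by (auto elim: weakly_small_mono)
    ultimately show ?case using near by simp
  next
    case (Cons z zs)
    have zs: "\<And>z. z \<in> set zs \<Longrightarrow> norm z \<le> 2 \<and> weakly_small \<Phi> \<delta> z" using Cons.prems(4) by simp
    have z: "norm z \<le> 2" "weakly_small \<Phi> \<delta> z" using Cons.prems(4) by simp_all
    let ?c = "if zs = [] then P y else 0"
    have 1: "norm (diffs zs P (y + u) - ?c) < 2 ^ length zs * e'"
      using Cons.IH[OF Cons.prems(1,2) _ zs] Cons.prems(3) by simp
    have "norm (u + z) \<le> 2 * Suc m"
      using Cons.prems(1) z(1) norm_triangle_ineq[of u z] by simp
    moreover have "weakly_small \<Phi> (Suc m * \<delta>) (u + z)"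
      unfolding weakly_small_def
    proof
      fix \<phi> assume p: "\<phi> \<in> \<Phi>"
      have "norm (\<phi> u) \<le> m * \<delta>" "norm (\<phi> z) \<le> \<delta>"
        using p Cons.prems(2) z(2) by (auto simp: weakly_small_def)
      moreover have "\<phi> (u + z) = \<phi> u + \<phi> z" using p \<Phi>(2) dual_UNIV_D(1) by blast
      moreover have "norm (\<phi> u + \<phi> z) \<le> norm (\<phi> u) + norm (\<phi> z)" by (rule norm_triangle_ineq)
      ultimately show "norm (\<phi> (u + z)) \<le> Suc m * \<delta>" by (simp add: algebra_simps)
    qed
    ultimately have 2: "norm (diffs zs P (y + (u + z)) - ?c) < 2 ^ length zs * e'"
      using Cons.IH[of "u + z" "Suc m", OF _ _ _ zs] Cons.prems(3) by simp
    have "diffs (z # zs) P (y + u) = (diffs zs P (y + (u + z)) - ?c) - (diffs zs P (y + u) - ?c)"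
      by (simp add: add.assoc)
    then have "norm (diffs (z # zs) P (y + u)) \<le> norm (diffs zs P (y + (u + z)) - ?c) + norm (diffs zs P (y + u) - ?c)"
      using norm_triangle_ineq4 by metis
    then have "norm (diffs (z # zs) P (y + u)) < 2 ^ length zs * e' + 2 ^ length zs * e'" using 1 2 by linarith
    then show ?case by (simp add: mult.commute mult.left_commute)
  qed
  show thesis
  proof (rule that[OF \<Phi> \<delta>])
    fix zs :: "'a list" assume zs: "length zs = Suc k" "\<And>z. z \<in> set zs \<Longrightarrow> norm z \<le> 2 \<and> weakly_small \<Phi> \<delta> z"
    have "weakly_small \<Phi> (real 0 * \<delta>) 0"
      using \<Phi>(2) dual_UNIV_D(3) by (fastforce simp: weakly_small_def)
    then have "norm (diffs zs P (y + 0) - (if zs = [] then P y else 0)) < 2 ^ length zs * e'"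
      by (intro bound[of 0 0]) (use zs in \<open>auto simp: K_def\<close>)
    moreover have "zs \<noteq> []" using zs(1) by auto
    ultimately show "norm (diffs zs P y) < e" using zs(1) by (simp add: e'_def K_def)
  qed
qed

lemma diffs_weakly_small_finite:
  fixes P :: "'a::real_normed_vector \<Rightarrow> 'b::real_normed_vector"
    and sE :: "'k::real_normed_field \<Rightarrow> 'a \<Rightarrow> 'a"
  assumes P: "weakly_cont_on_bounded sE P" and e: "e > 0" and "finite Y"
  shows "\<exists>\<Phi> \<delta>. finite \<Phi> \<and> \<Phi> \<subseteq> dual sE norm UNIV \<and> \<delta> > 0 \<and>
    (\<forall>y\<in>Y. \<forall>zs. length zs = Suc k \<longrightarrow> (\<forall>z\<in>set zs. norm z \<le> 2 \<and> weakly_small \<Phi> \<delta> z) \<longrightarrow>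
       norm (diffs zs P y) < e)"
  using \<open>finite Y\<close>
proof induction
  case empty
  show ?case by (intro exI[of _ "{}"] exI[of _ 1]) simp
next
  case (insert y Y)
  then obtain \<Phi> \<delta> where 1: "finite \<Phi>" "\<Phi> \<subseteq> dual sE norm UNIV" "\<delta> > 0"
    "\<And>y zs. y \<in> Y \<Longrightarrow> length zs = Suc k \<Longrightarrow> (\<forall>z\<in>set zs. norm z \<le> 2 \<and> weakly_small \<Phi> \<delta> z) \<Longrightarrow>
       norm (diffs zs P y) < e" by blast
  obtain \<Psi> \<eta> where 2: "finite \<Psi>" "\<Psi> \<subseteq> dual sE norm UNIV" "\<eta> > 0"
    "\<And>zs. length zs = Suc k \<Longrightarrow> (\<And>z. z \<in> set zs \<Longrightarrow> norm z \<le> 2 \<and> weakly_small \<Psi> \<eta> z) \<Longrightarrow>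
       norm (diffs zs P y) < e" using diffs_weakly_small[OF P e, of k y] by metis
  have m1: "weakly_small \<Phi> \<delta> z" and m2: "weakly_small \<Psi> \<eta> z"
    if "weakly_small (\<Phi> \<union> \<Psi>) (min \<delta> \<eta>) z" for z
    using weakly_small_mono[OF that] by auto
  show ?case
  proof (intro exI[of _ "\<Phi> \<union> \<Psi>"] exI[of _ "min \<delta> \<eta>"] conjI ballI allI impI)
    fix y' zs assume y': "y' \<in> insert y Y" and zs: "length zs = Suc k"
      and small: "\<forall>z\<in>set zs. norm z \<le> 2 \<and> weakly_small (\<Phi> \<union> \<Psi>) (min \<delta> \<eta>) z"
    show "norm (diffs zs P y') < e"
    proof (cases "y' = y")
      case True
      have "norm (diffs zs P y) < e" by (rule 2(4)[OF zs]) (use small m2 in blast)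
      then show ?thesis using True by simp
    next
      case False
      then have "y' \<in> Y" using y' by blast
      then show ?thesis by (rule 1(4)[OF _ zs]) (use small m1 in blast)
    qed
  qed (use 1 2 in auto)
qed

text \<open>The finitely many functionals map the ball to a totally bounded set.\<close>
lemma bounded_seq_weak_pigeonhole:
  fixes y :: "nat \<Rightarrow> 'a::real_normed_vector" and sE :: "'k::real_or_complex \<Rightarrow> 'a \<Rightarrow> 'a"
  assumes y: "\<And>j. norm (y j) \<le> 1" and "finite \<Phi>" "\<Phi> \<subseteq> dual sE norm UNIV" and \<delta>: "\<delta> > 0"
  obtains i j where "i < j" "weakly_small \<Phi> \<delta> (y j - y i)"
proof -
  have "\<exists>r::nat\<Rightarrow>nat. strict_mono r \<and> (\<forall>\<phi>\<in>\<Phi>. convergent (\<lambda>k. \<phi> (y (r k))))"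
    using assms(2,3)
  proof (induction)
    case empty
    show ?case by (rule exI[of _ id]) (simp add: strict_mono_def)
  next
    case (insert \<phi> \<Phi>)
    then obtain r :: "nat \<Rightarrow> nat" where r: "strict_mono r" "\<And>\<psi>. \<psi> \<in> \<Phi> \<Longrightarrow> convergent (\<lambda>k. \<psi> (y (r k)))" by blast
    obtain C where C: "\<And>x. norm (\<phi> x) \<le> C * norm x"
      using dual_UNIV_D(6)[of \<phi> sE norm] insert.prems by blast
    have "norm (\<phi> (y j)) \<le> \<bar>C\<bar>" for j
    proof -
      have "C * norm (y j) \<le> \<bar>C\<bar> * 1" using y[of j] by (intro mult_mono) auto
      then show ?thesis using C[of "y j"] by simp
    qed
    then have "\<forall>k. \<phi> (y (r k)) \<in> cball 0 \<bar>C\<bar>" by simp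
    then obtain l s where s: "strict_mono s" "((\<lambda>k. \<phi> (y (r k))) \<circ> s) \<longlonglongrightarrow> l"
      using compact_scalar_cball[where 'k = 'k and r = "\<bar>C\<bar>", unfolded compact_def, rule_format,
        of "\<lambda>k. \<phi> (y (r k))"] by blast
    have "convergent (\<lambda>k. \<psi> (y ((r \<circ> s) k)))" if "\<psi> \<in> insert \<phi> \<Phi>" for \<psi>
    proof (cases "\<psi> = \<phi>")
      case True
      then show ?thesis using s(2) by (auto simp: convergent_def comp_def)
    next
      case False
      then have "convergent ((\<lambda>k. \<psi> (y (r k))) \<circ> s)"
        using convergent_subseq_convergent[OF r(2) s(1)] that by blast
      then show ?thesis by (simp add: comp_def)
    qed
    then show ?case using strict_mono_o[OF r(1) s(1)] by blast
  qed
  then obtain r :: "nat \<Rightarrow> nat" where r: "strict_mono r" "\<And>\<phi>. \<phi> \<in> \<Phi> \<Longrightarrow> convergent (\<lambda>k. \<phi> (y (r k)))" by blast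
  have "eventually (\<lambda>k. norm (\<phi> (y (r (Suc k)) - y (r k))) \<le> \<delta>) sequentially" if p: "\<phi> \<in> \<Phi>" for \<phi>
  proof -
    have "Cauchy (\<lambda>k. \<phi> (y (r k)))" using r(2)[OF p] by (rule convergent_Cauchy)
    then obtain M where M: "\<forall>m\<ge>M. \<forall>n\<ge>M. norm (\<phi> (y (r m)) - \<phi> (y (r n))) < \<delta>"
      using \<delta> unfolding Cauchy_iff by blast
    have "norm (\<phi> (y (r (Suc k)) - y (r k))) \<le> \<delta>" if "k \<ge> M" for k
    proof -
      have "norm (\<phi> (y (r (Suc k))) - \<phi> (y (r k))) < \<delta>" using M that by simp
      then show ?thesis
        using dual_UNIV_D(5)[of \<phi> sE norm] p assms(3) by (metis less_imp_le subsetD)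
    qed
    then show ?thesis unfolding eventually_sequentially by blast
  qed
  then have "eventually (\<lambda>k. \<forall>\<phi>\<in>\<Phi>. norm (\<phi> (y (r (Suc k)) - y (r k))) \<le> \<delta>) sequentially"
    using assms(2) by (simp add: eventually_ball_finite_distrib)
  then obtain k where "\<forall>\<phi>\<in>\<Phi>. norm (\<phi> (y (r (Suc k)) - y (r k))) \<le> \<delta>"
    using eventually_happens'[OF sequentially_bot] by blast
  moreover have "r k < r (Suc k)" using r(1) by (simp add: strict_mono_def)
  ultimately show thesis using that unfolding weakly_small_def by blast
qed

text \<open>
  Suppose that uniform continuity fails for \<open>e\<close>. Then in every weak neighbourhood of zero there is one
  step whose first difference is at least \<open>e\<close>, at some point of the ball. If this holds for differences
  of order \<open>k + 1\<close> with a bound \<open>c\<close>, choose points \<open>y\<^sub>0, y\<^sub>1, \<dots>\<close> of the ball successively, with steps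
  for \<open>y\<^sub>j\<close> that are so small weakly that their differences at all earlier points are below \<open>c / 2\<close>. Two of these
  points, say \<open>y\<^sub>i\<close> and \<open>y\<^sub>j\<close> with \<open>i < j\<close>, are weakly close; with \<open>y\<^sub>j - y\<^sub>i\<close> as an additional step, the steps of
  \<open>y\<^sub>j\<close> give a difference of one order more at \<open>y\<^sub>i\<close> that is at least \<open>c / 2\<close>. Beyond the degree of \<open>P\<close>
  this is absurd.
\<close>
lemma weakly_cont_imp_uniformly:
  fixes P :: "'a::real_normed_vector \<Rightarrow> 'b::real_normed_vector"
    and sE :: "'k::real_or_complex \<Rightarrow> 'a \<Rightarrow> 'a"
  assumes P: "weakly_cont_on_bounded sE P" and deg: "degree_le n P" and e: "e > 0"
  shows "\<exists>\<Phi> \<delta>. finite \<Phi> \<and> \<Phi> \<subseteq> dual sE norm UNIV \<and> \<delta> > 0 \<and>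
    (\<forall>x y. norm x \<le> 1 \<longrightarrow> norm y \<le> 1 \<longrightarrow> weakly_small \<Phi> \<delta> (x - y) \<longrightarrow> norm (P x - P y) < e)"
proof (rule ccontr)
  assume "\<not> ?thesis"
  then have no: "\<exists>x y. norm x \<le> 1 \<and> norm y \<le> 1 \<and> weakly_small \<Phi> \<delta> (x - y) \<and> norm (P x - P y) \<ge> e"
    if "finite \<Phi>" "\<Phi> \<subseteq> dual sE norm UNIV" "\<delta> > 0" for \<Phi> \<delta>
    using that by (meson not_less)
  define bad where "bad k \<Phi> \<delta> y zs \<longleftrightarrow> norm y \<le> 1 \<and> length zs = Suc k \<and>
    (\<forall>z\<in>set zs. norm z \<le> 2 \<and> weakly_small \<Phi> \<delta> z) \<and> norm (diffs zs P y) \<ge> e / 2 ^ k"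
    for k and \<Phi> :: "('a \<Rightarrow> 'k) set" and \<delta> :: real and y :: 'a and zs :: "'a list"
  have bad: "\<exists>y zs. bad k \<Phi> \<delta> y zs" if "finite \<Phi>" "\<Phi> \<subseteq> dual sE norm UNIV" "\<delta> > 0" for k \<Phi> \<delta>
    using that
  proof (induction k arbitrary: \<Phi> \<delta>)
    case 0
    then obtain x y where xy: "norm x \<le> 1" "norm y \<le> 1" "weakly_small \<Phi> \<delta> (x - y)" "norm (P x - P y) \<ge> e"
      using no by blast
    have "norm (x - y) \<le> 2" using norm_triangle_ineq4[of x y] xy by simp
    then have "bad 0 \<Phi> \<delta> y [x - y]" using xy by (simp add: bad_def)
    then show ?case by blast
  next
    case (Suc k)
    have e2: "e / 2 ^ Suc k > 0" using e by simp
    let ?Q = "\<lambda>f j r. bad k \<Phi> \<delta> (fst r) (snd r) \<and>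
      (\<forall>i<j. norm (diffs (snd r) P (fst (f i))) < e / 2 ^ Suc k)"
    have "\<exists>f :: nat \<Rightarrow> 'a \<times> 'a list. \<forall>j. ?Q f j (f j)"
    proof (rule dependent_wellorder_choice)
      fix f :: "nat \<Rightarrow> 'a \<times> 'a list" and j
      have "finite ((fst \<circ> f) ` {..<j})" by simp
      from diffs_weakly_small_finite[OF P e2 this, of k]
      obtain \<Psi> \<eta> where \<Psi>: "finite \<Psi>" "\<Psi> \<subseteq> dual sE norm UNIV" "\<eta> > 0"
        "\<And>i zs. i < j \<Longrightarrow> length zs = Suc k \<Longrightarrow> (\<forall>z\<in>set zs. norm z \<le> 2 \<and> weakly_small \<Psi> \<eta> z) \<Longrightarrow>
          norm (diffs zs P (fst (f i))) < e / 2 ^ Suc k" by fastforce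
      have "\<exists>y zs. bad k (\<Phi> \<union> \<Psi>) (min \<delta> \<eta>) y zs"
        by (rule Suc.IH) (use Suc.prems \<Psi> in auto)
      then obtain y zs where b: "bad k (\<Phi> \<union> \<Psi>) (min \<delta> \<eta>) y zs" by blast
      have small: "weakly_small \<Phi> \<delta> z" "weakly_small \<Psi> \<eta> z" if "z \<in> set zs" for z
      proof -
        have "weakly_small (\<Phi> \<union> \<Psi>) (min \<delta> \<eta>) z" using b that by (simp add: bad_def)
        then show "weakly_small \<Phi> \<delta> z" "weakly_small \<Psi> \<eta> z" by (auto elim: weakly_small_mono)
      qed
      have "bad k \<Phi> \<delta> y zs" using b small by (simp add: bad_def)
      moreover have "norm (diffs zs P (fst (f i))) < e / 2 ^ Suc k" if "i < j" for i
        using b small by (intro \<Psi>(4)[OF that]) (simp_all add: bad_def)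
      ultimately have "?Q f j (y, zs)" by simp
      then show "\<exists>r. ?Q f j r" by blast
    qed simp
    then obtain f :: "nat \<Rightarrow> 'a \<times> 'a list" where f: "\<And>j. ?Q f j (f j)" by blast
    have f1: "norm (fst (f j)) \<le> 1" for j using f[of j] by (simp add: bad_def)
    obtain i j where ij: "i < j" "weakly_small \<Phi> \<delta> (fst (f j) - fst (f i))"
      using bounded_seq_weak_pigeonhole[of "\<lambda>j. fst (f j)", OF f1 Suc.prems] by blast
    let ?w = "fst (f j) - fst (f i)" and ?zs = "snd (f j)"
    have bj: "bad k \<Phi> \<delta> (fst (f j)) ?zs" and lt: "norm (diffs ?zs P (fst (f i))) < e / 2 ^ Suc k"
      using f[of j] ij(1) by blast+
    have "norm ?w \<le> 2" using norm_triangle_ineq4[of "fst (f j)" "fst (f i)"] f1[of i] f1[of j] by simp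
    moreover have "norm (diffs (?w # ?zs) P (fst (f i))) \<ge> e / 2 ^ Suc k"
    proof -
      have "norm (diffs (?w # ?zs) P (fst (f i))) = norm (diffs ?zs P (fst (f j)) - diffs ?zs P (fst (f i)))" by simp
      moreover have "norm (diffs ?zs P (fst (f j))) - norm (diffs ?zs P (fst (f i)))
          \<le> norm (diffs ?zs P (fst (f j)) - diffs ?zs P (fst (f i)))" by (rule norm_triangle_ineq2)
      moreover have "norm (diffs ?zs P (fst (f j))) \<ge> e / 2 ^ k" using bj by (simp add: bad_def)
      moreover define c where "c = e / 2 ^ Suc k"
      moreover have "e / 2 ^ k = c + c" by (simp add: c_def)
      ultimately show ?thesis using lt unfolding c_def[symmetric] by linarith
    qed
    ultimately have "bad (Suc k) \<Phi> \<delta> (fst (f i)) (?w # ?zs)"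
      using bj ij(2) f1[of i] unfolding bad_def by auto
    then show ?case by blast
  qed
  from bad[of "{}" 1 n] obtain y zs where "bad n {} 1 y zs" by auto
  then have "length zs = Suc n" "norm (diffs zs P y) \<ge> e / 2 ^ n" by (auto simp: bad_def)
  moreover have "e / 2 ^ n > 0" using e by simp
  ultimately show False using degree_le_diffs[OF deg, of zs y] by simp
qed

text \<open>Otherwise some sequence in the ball has \<open>e\<close>-separated images, but two of its points are weakly close.\<close>
lemma weakly_cont_image_totally_bounded:
  fixes P :: "'a::real_normed_vector \<Rightarrow> 'b::real_normed_vector"
    and sE :: "'k::real_or_complex \<Rightarrow> 'a \<Rightarrow> 'a"
  assumes P: "weakly_cont_on_bounded sE P" and deg: "degree_le n P" and e: "e > 0"
  obtains T where "finite T" "T \<subseteq> cball 0 1" "\<And>x. norm x \<le> 1 \<Longrightarrow> \<exists>t\<in>T. norm (P x - P t) < e"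
proof (rule ccontr)
  assume "\<not> thesis"
  then have no: "\<exists>x. norm x \<le> 1 \<and> (\<forall>t\<in>T. norm (P x - P t) \<ge> e)" if "finite T" "T \<subseteq> cball 0 1" for T
    using that \<open>\<And>T. finite T \<Longrightarrow> T \<subseteq> cball 0 1 \<Longrightarrow> (\<And>x. norm x \<le> 1 \<Longrightarrow> \<exists>t\<in>T. norm (P x - P t) < e) \<Longrightarrow> thesis\<close>
    by (meson not_less)
  let ?Q = "\<lambda>y j r. norm r \<le> 1 \<and> (\<forall>i<j. norm (y i) \<le> 1 \<longrightarrow> norm (P r - P (y i)) \<ge> e)"
  have "\<exists>y :: nat \<Rightarrow> 'a. \<forall>j. ?Q y j (y j)"
  proof (rule dependent_wellorder_choice)
    fix y :: "nat \<Rightarrow> 'a" and j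
    show "\<exists>r. ?Q y j r"
      using no[of "y ` {i. i < j \<and> norm (y i) \<le> 1}"] by fastforce
  qed simp
  then obtain y :: "nat \<Rightarrow> 'a" where y: "\<And>j. ?Q y j (y j)" by blast
  obtain \<Phi> \<delta> where \<Phi>: "finite \<Phi>" "\<Phi> \<subseteq> dual sE norm UNIV" "\<delta> > 0"
    "\<And>x y. norm x \<le> 1 \<Longrightarrow> norm y \<le> 1 \<Longrightarrow> weakly_small \<Phi> \<delta> (x - y) \<Longrightarrow> norm (P x - P y) < e"
    using weakly_cont_imp_uniformly[OF P deg e] by blast
  have y1: "norm (y j) \<le> 1" for j using y by blast
  obtain i j where ij: "i < j" "weakly_small \<Phi> \<delta> (y j - y i)"
    using bounded_seq_weak_pigeonhole[of y, OF y1 \<Phi>(1-3)] by blast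
  then have "norm (P (y j) - P (y i)) < e" using \<Phi>(4) y1 by blast
  moreover have "norm (P (y j) - P (y i)) \<ge> e" using y[of j] ij(1) y1 by blast
  ultimately show False by simp
qed

section \<open>Compact operators make polynomials weakly continuous\<close>

lemma dual_UNIV_linear:
  fixes sF :: "'k::real_or_complex \<Rightarrow> 'b::banach \<Rightarrow> 'b"
  assumes "banach_over sF" and \<phi>: "\<phi> \<in> dual sF norm UNIV"
  shows "Vector_Spaces.linear sF (*) \<phi>" "continuous_on UNIV \<phi>"
proof -
  interpret F: banach_over sF by fact
  have k: "vector_space ((*) :: 'k \<Rightarrow> 'k \<Rightarrow> 'k)"
    by standard (simp_all add: algebra_simps)
  show "Vector_Spaces.linear sF (*) \<phi>"
    unfolding Vector_Spaces.linear_iff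
    using k F.vector_space_axioms dual_UNIV_D(1,2)[OF \<phi>] by blast
  obtain C where C: "\<And>x. norm (\<phi> x) \<le> C * norm x" using dual_UNIV_D(6)[OF \<phi>] by blast
  have "bounded_linear \<phi>"
  proof (rule bounded_linear_intro[where K = C])
    show "\<phi> (r *\<^sub>R x) = r *\<^sub>R \<phi> x" for r x
      using dual_UNIV_D(2)[OF \<phi>, of "of_real r" x] by (simp add: F.scale_of_real scaleR_conv_of_real)
  qed (use C dual_UNIV_D(1)[OF \<phi>] in \<open>simp_all add: mult.commute\<close>)
  then show "continuous_on UNIV \<phi>" by (rule bounded_linear.continuous_on) (rule continuous_on_id)
qed

text \<open>
  On a compact set the norm topology coincides with every coarser Hausdorff topology, and the weak
  topology is Hausdorff by the Hahn--Banach theorem.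
\<close>
lemma compact_weak_tendsto_imp_tendsto:
  fixes sF :: "'k::real_or_complex \<Rightarrow> 'b::banach \<Rightarrow> 'b"
  assumes F: "banach_over sF" and S: "compact S" "eventually (\<lambda>u. f u \<in> S) G"
    and w: "\<And>\<phi>. \<phi> \<in> dual sF norm UNIV \<Longrightarrow> ((\<lambda>u. \<phi> (f u)) \<longlongrightarrow> \<phi> l) G"
  shows "(f \<longlongrightarrow> l) G"
proof (rule topological_tendstoI, rule ccontr)
  fix V assume O: "open V" "l \<in> V" and not: "\<not> eventually (\<lambda>u. f u \<in> V) G"
  define H where "H = inf (filtermap f G) (principal (- V))"
  have "H \<noteq> bot"
    using not unfolding H_def trivial_limit_def eventually_inf_principal eventually_filtermap by simp
  moreover have "eventually (\<lambda>y. y \<in> S) H"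
    using S(2) unfolding H_def eventually_inf_principal eventually_filtermap by (rule eventually_mono) simp
  ultimately obtain s where s: "inf (nhds s) H \<noteq> bot"
    using S(1) unfolding compact_filter by blast
  have "s = l"
  proof (rule ccontr)
    assume "s \<noteq> l"
    then have "s - l \<noteq> 0" by simp
    then obtain \<phi> where \<phi>: "\<phi> \<in> dual sF norm UNIV" "\<phi> (s - l) \<noteq> 0"
      using dual_separates_points[OF F] by blast
    have "(\<phi> \<longlongrightarrow> \<phi> s) (nhds s)"
      using dual_UNIV_linear(2)[OF F \<phi>(1)] by (simp add: continuous_on_eq_continuous_at isCont_def tendsto_at_iff_tendsto_nhds)
    then have "(\<phi> \<longlongrightarrow> \<phi> s) (inf (nhds s) H)" by (rule tendsto_mono[rotated]) simp
    moreover have "(\<phi> \<longlongrightarrow> \<phi> l) (filtermap f G)" using w[OF \<phi>(1)] by (simp add: filterlim_filtermap)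
    then have "(\<phi> \<longlongrightarrow> \<phi> l) (inf (nhds s) H)"
      by (rule tendsto_mono[rotated]) (simp add: H_def le_infI2)
    ultimately have "\<phi> s = \<phi> l" using s tendsto_unique by blast
    then show False using \<phi>(2) dual_UNIV_D(5)[OF \<phi>(1)] by simp
  qed
  have "eventually (\<lambda>y. y \<in> V) (inf (nhds s) H)"
    using O \<open>s = l\<close> eventually_nhds_in_open by (blast intro: filter_leD[OF inf_le1])
  moreover have "eventually (\<lambda>y. y \<notin> V) H" by (simp add: H_def eventually_inf_principal)
  then have "eventually (\<lambda>y. y \<notin> V) (inf (nhds s) H)" by (rule filter_leD[OF inf_le2])
  ultimately have "eventually (\<lambda>y. False) (inf (nhds s) H)" by eventually_elim simp
  then show False using s by (simp add: trivial_limit_def)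
qed

text \<open>
  Below the critical degree each scalar polynomial \<open>\<phi> \<circ> T \<circ> P\<close> is weakly continuous on bounded sets,
  and \<open>T \<circ> P\<close> maps bounded sets into compact ones.
\<close>
lemma (in polynomials) compact_compose_in_polys_w:
  assumes cd: "enat n < critical_degree sE" and P: "P \<in> X" and T: "compact_operator sF T"
  shows "(\<lambda>x. T (P x)) \<in> J"
proof -
  have lin: "Vector_Spaces.linear sF sF T" and bl: "bounded_linear T"
    and comp: "compact (closure (T ` cball 0 1))" using T by (simp_all add: compact_operator_def)
  have TP: "(\<lambda>x. T (P x)) \<in> X"
    using polys_compose[OF P lin] bounded_linear.continuous_on[OF bl continuous_on_id] by blast
  have "n \<notin> {k. 1 \<le> k \<and> polys_w k sE ((*) :: 'k \<Rightarrow> 'k \<Rightarrow> 'k) \<noteq> polys k sE (*)}"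
    (is "n \<notin> ?K")
  proof
    assume "n \<in> ?K"
    then have "critical_degree sE \<le> enat n" unfolding critical_degree_def by (rule INF_lower)
    then show False using cd by simp
  qed
  then have scalar: "polys_w n sE ((*) :: 'k \<Rightarrow> 'k \<Rightarrow> 'k) = polys n sE (*)" using n by blast
  have "weakly_cont_on_bounded sE (\<lambda>x. T (P x))"
    unfolding weakly_cont_on_bounded_def
  proof (intro allI impI)
    fix G :: "'a filter" and x r
    assume G: "eventually (\<lambda>u. norm u \<le> r) G" "weakly_converges sE G x"
    define R where "R = max r 1"
    have R: "R > 0" "r \<le> R" by (auto simp: R_def)
    define M where "M = R ^ n * nrm P + 1"
    have M: "M > 0" using R poly_norm_nonneg[OF P] by (simp add: M_def add_nonneg_pos)
    have in_S: "T (P u) \<in> (*\<^sub>R) M ` closure (T ` cball 0 1)" if "norm u \<le> r" for u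
    proof -
      have "norm (P u) \<le> M" using norm_le_on_bounded[OF P, of u R] that R by (simp add: M_def)
      then have "norm (inverse M *\<^sub>R P u) \<le> 1" using M by (simp add: field_simps)
      then have "T (inverse M *\<^sub>R P u) \<in> closure (T ` cball 0 1)"
        by (intro subsetD[OF closure_subset] imageI) simp
      moreover have "T (P u) = M *\<^sub>R T (inverse M *\<^sub>R P u)"
        using M by (simp add: linear_simps(5)[OF bl])
      ultimately show ?thesis by blast
    qed
    show "((\<lambda>x. T (P x)) \<longlongrightarrow> T (P x)) G"
    proof (rule compact_weak_tendsto_imp_tendsto[OF F.banach_over_axioms])
      show "compact ((*\<^sub>R) M ` closure (T ` cball 0 1))" using comp by (rule compact_scaling)
      show "eventually (\<lambda>u. T (P u) \<in> (*\<^sub>R) M ` closure (T ` cball 0 1)) G"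
        using G(1) by (rule eventually_mono) (rule in_S)
      fix \<phi> assume \<phi>: "\<phi> \<in> dual sF norm (UNIV :: 'b set)"
      have "(\<lambda>x. \<phi> (T (P x))) \<in> polys n sE (*)"
        by (rule polys_compose[OF TP dual_UNIV_linear[OF F.banach_over_axioms \<phi>]])
      then have "weakly_cont_on_bounded sE (\<lambda>x. \<phi> (T (P x)))"
        unfolding scalar[symmetric] by (simp add: polys_w_def)
      then show "((\<lambda>x. \<phi> (T (P x))) \<longlongrightarrow> \<phi> (T (P x))) G"
        using G unfolding weakly_cont_on_bounded_def by blast
    qed
  qed
  then show ?thesis using TP by (simp add: polys_w_def)
qed

section \<open>The projection on the dual\<close>

text \<open>
  The net of compact operators enters only through its filter of tails \<open>N\<close>.
\<close>
locale compact_approximation = polynomials sE sF n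
  for sE :: "'k::real_or_complex \<Rightarrow> 'a::banach \<Rightarrow> 'a" and sF :: "'k \<Rightarrow> 'b::banach \<Rightarrow> 'b" and n :: nat +
  fixes L :: "'i \<Rightarrow> 'b \<Rightarrow> 'b" and N :: "'i filter"
  assumes cd: "enat n < critical_degree sE"
    and L_compact: "compact_operator sF (L \<beta>)"
    and L_contraction: "norm (L \<beta> y) \<le> norm y"
    and L_cocontraction: "norm (y - L \<beta> y) \<le> norm y"
    and N_nontrivial: "N \<noteq> bot"
    and L_tendsto: "((\<lambda>\<beta>. L \<beta> y) \<longlongrightarrow> y) N"
    and L_combination: "\<epsilon> > 0 \<Longrightarrow> \<exists>\<mu>>0. eventually (\<lambda>\<beta>. \<forall>y z. norm y \<le> 1 \<longrightarrow> norm z \<le> 1 \<longrightarrow>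
        norm (L \<beta> y + \<mu> *\<^sub>R (z - L \<beta> z)) \<le> 1 + \<epsilon> * \<mu>) N"
begin

abbreviation "psc \<equiv> (pointwise_scale sF :: 'k \<Rightarrow> ('a \<Rightarrow> 'b) \<Rightarrow> 'a \<Rightarrow> 'b)"
abbreviation "D \<equiv> dual psc nrm X"
abbreviation "dnorm \<equiv> (dual_norm nrm X :: (('a \<Rightarrow> 'b) \<Rightarrow> 'k) \<Rightarrow> real)"

definition S :: "'i \<Rightarrow> ('a \<Rightarrow> 'b) \<Rightarrow> 'a \<Rightarrow> 'b"
  where "S \<beta> P = (\<lambda>x. L \<beta> (P x))"

lemma L_linear: "Vector_Spaces.linear sF sF (L \<beta>)"
  using L_compact by (simp add: compact_operator_def)

lemma S_in_J: "P \<in> X \<Longrightarrow> S \<beta> P \<in> J"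
  unfolding S_def by (rule compact_compose_in_polys_w[OF cd _ L_compact])

lemma J_in_X: "P \<in> J \<Longrightarrow> P \<in> X"
  by (simp add: polys_w_def)

lemma S_in_X: "P \<in> X \<Longrightarrow> S \<beta> P \<in> X"
  by (rule J_in_X[OF S_in_J])

lemma S_add: "S \<beta> (P + Q) = S \<beta> P + S \<beta> Q"
  by (rule ext) (simp only: S_def plus_fun_apply linearD(1)[OF L_linear])

lemma S_scale: "S \<beta> (psc c P) = psc c (S \<beta> P)"
  by (rule ext) (simp only: S_def pointwise_scale_def linearD(2)[OF L_linear])

lemma poly_norm_S: "P \<in> X \<Longrightarrow> nrm (S \<beta> P) \<le> nrm P"
  by (rule poly_norm_le) (metis S_def L_contraction norm_le_poly_norm order_trans)

lemma poly_norm_diff_S: "P \<in> X \<Longrightarrow> nrm (P - S \<beta> P) \<le> nrm P"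
  by (rule poly_norm_le) (metis S_def L_cocontraction minus_apply norm_le_poly_norm order_trans)

lemma poly_norm_scale: "P \<in> X \<Longrightarrow> nrm (psc c P) \<le> norm c * nrm P"
  by (rule poly_norm_le) (simp add: pointwise_scale_def F.norm_scale norm_le_poly_norm mult_left_mono)

lemma dualD:
  assumes "f \<in> D"
  shows "P \<in> X \<Longrightarrow> Q \<in> X \<Longrightarrow> f (P + Q) = f P + f Q" "P \<in> X \<Longrightarrow> f (psc c P) = c * f P"
    "P \<notin> X \<Longrightarrow> f P = 0" "\<exists>C. \<forall>P\<in>X. norm (f P) \<le> C * nrm P"
  using assms by (auto simp: dual_def linear_on_carrier_def)

lemma dual_diff:
  assumes f: "f \<in> D" and "P \<in> X" "Q \<in> X"
  shows "f (P - Q) = f P - f Q"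
  using dualD(1)[OF f polys_diff[OF assms(2,3)] assms(3)] by simp

lemma zero_in_unit_ball: "0 \<in> {P\<in>X. nrm P \<le> 1}"
  using J_in_X[OF zero_in_polys_w] poly_norm_le[of 0 1] by simp

lemma dual_norm_upper:
  assumes f: "f \<in> D" and "P \<in> X" "nrm P \<le> 1"
  shows "norm (f P) \<le> dnorm f"
  unfolding dual_norm_def
proof (rule cSUP_upper)
  obtain C where C: "\<And>P. P \<in> X \<Longrightarrow> norm (f P) \<le> C * nrm P" using dualD(4)[OF f] by blast
  show "bdd_above ((\<lambda>P. norm (f P)) ` {P\<in>X. nrm P \<le> 1})"
  proof (rule bdd_aboveI2)
    fix P assume P: "P \<in> {P\<in>X. nrm P \<le> 1}"
    then have "C * nrm P \<le> \<bar>C\<bar> * 1" using poly_norm_nonneg by (intro mult_mono) auto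
    then show "norm (f P) \<le> \<bar>C\<bar>" using C[of P] P by simp
  qed
qed (use assms in auto)

lemma dual_norm_least: "(\<And>P. P \<in> X \<Longrightarrow> nrm P \<le> 1 \<Longrightarrow> norm (f P) \<le> C) \<Longrightarrow> dnorm f \<le> C"
  unfolding dual_norm_def by (rule cSUP_least) (use zero_in_unit_ball in auto)

lemma dual_norm_nonneg: "f \<in> D \<Longrightarrow> 0 \<le> dnorm f"
  using dual_norm_upper[of f 0] zero_in_unit_ball norm_ge_zero order_trans by blast

lemma normalize:
  assumes P: "P \<in> X" "nrm P > 0"
  shows "psc (of_real (inverse (nrm P))) P \<in> X" "nrm (psc (of_real (inverse (nrm P))) P) \<le> 1"
proof -
  show "psc (of_real (inverse (nrm P))) P \<in> X" by (rule polys_scale[OF P(1)])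
  have "norm (of_real (inverse (nrm P)) :: 'k) * nrm P = 1"
    using P(2) by (simp only: norm_of_real) simp
  then show "nrm (psc (of_real (inverse (nrm P))) P) \<le> 1"
    using poly_norm_scale[OF P(1), of "of_real (inverse (nrm P))"] by simp
qed

lemma norm_dual_le:
  assumes f: "f \<in> D" and P: "P \<in> X"
  shows "norm (f P) \<le> dnorm f * nrm P"
proof (cases "nrm P = 0")
  case True
  obtain C where "norm (f P) \<le> C * nrm P" using dualD(4)[OF f] P by blast
  then show ?thesis using True by simp
next
  case False
  then have p: "nrm P > 0" using poly_norm_nonneg[OF P] by simp
  have "norm (f (psc (of_real (inverse (nrm P))) P)) \<le> dnorm f"
    by (rule dual_norm_upper[OF f normalize[OF P p]])
  then have "inverse (nrm P) * norm (f P) \<le> dnorm f"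
    using p by (simp only: dualD(2)[OF f P] norm_mult norm_of_real) simp
  then show ?thesis using p by (simp add: field_simps)
qed

text \<open>
  The limits in \<open>q\<close> are taken along one and the same maximal filter, so that all of them exist and
  \<open>q\<close> is linear.
\<close>
definition U :: "'i filter"
  where "U = (SOME U. U \<le> N \<and> U \<noteq> bot \<and> (\<forall>G. G \<le> U \<longrightarrow> G \<noteq> bot \<longrightarrow> G = U))"

lemma U: "U \<le> N" "U \<noteq> bot" "\<And>G. G \<le> U \<Longrightarrow> G \<noteq> bot \<Longrightarrow> G = U"
proof -
  have "\<exists>U. U \<le> N \<and> U \<noteq> bot \<and> (\<forall>G. G \<le> U \<longrightarrow> G \<noteq> bot \<longrightarrow> G = U)"
    using ex_maximal_filter[OF N_nontrivial] by metis
  from someI_ex[OF this] show "U \<le> N" "U \<noteq> bot" "\<And>G. G \<le> U \<Longrightarrow> G \<noteq> bot \<Longrightarrow> G = U"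
    unfolding U_def by blast+
qed

definition q :: "(('a \<Rightarrow> 'b) \<Rightarrow> 'k) \<Rightarrow> ('a \<Rightarrow> 'b) \<Rightarrow> 'k"
  where "q f = (\<lambda>P. if P \<in> X then Lim U (\<lambda>\<beta>. f (S \<beta> P)) else 0)"

lemma q_eqI: "P \<in> X \<Longrightarrow> ((\<lambda>\<beta>. f (S \<beta> P)) \<longlongrightarrow> l) U \<Longrightarrow> q f P = l"
  unfolding q_def using tendsto_Lim[OF U(2)] by simp

lemma norm_f_S_le:
  assumes f: "f \<in> D" and P: "P \<in> X"
  shows "norm (f (S \<beta> P)) \<le> dnorm f * nrm P"
  using norm_dual_le[OF f S_in_X[OF P]] mult_left_mono[OF poly_norm_S[OF P] dual_norm_nonneg[OF f]]
  by (rule order_trans)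

lemma q_tendsto:
  assumes f: "f \<in> D" and P: "P \<in> X"
  shows "((\<lambda>\<beta>. f (S \<beta> P)) \<longlongrightarrow> q f P) U"
proof -
  have "eventually (\<lambda>\<beta>. f (S \<beta> P) \<in> cball 0 (dnorm f * nrm P)) U"
    using norm_f_S_le[OF f P] by simp
  then obtain l where "((\<lambda>\<beta>. f (S \<beta> P)) \<longlongrightarrow> l) U"
    using maximal_filter_limit[OF U(2,3) compact_scalar_cball] by metis
  then show ?thesis using q_eqI[OF P] by metis
qed

lemma q_in_dual:
  assumes f: "f \<in> D"
  shows "q f \<in> D"
  unfolding dual_def linear_on_carrier_def mem_Collect_eq
proof (intro conjI ballI allI impI exI[of _ "dnorm f"])
  fix P Q assume P: "P \<in> X" and Q: "Q \<in> X"
  show "q f (P + Q) = q f P + q f Q"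
  proof (rule q_eqI[OF polys_add[OF P Q]])
    have "((\<lambda>\<beta>. f (S \<beta> P) + f (S \<beta> Q)) \<longlongrightarrow> q f P + q f Q) U"
      by (intro tendsto_add q_tendsto f P Q)
    then show "((\<lambda>\<beta>. f (S \<beta> (P + Q))) \<longlongrightarrow> q f P + q f Q) U"
      by (simp only: S_add dualD(1)[OF f S_in_X[OF P] S_in_X[OF Q]])
  qed
next
  fix c P assume P: "P \<in> X"
  show "q f (psc c P) = c * q f P"
  proof (rule q_eqI[OF polys_scale[OF P]])
    have "((\<lambda>\<beta>. c * f (S \<beta> P)) \<longlongrightarrow> c * q f P) U"
      by (intro tendsto_mult tendsto_const q_tendsto f P)
    then show "((\<lambda>\<beta>. f (S \<beta> (psc c P))) \<longlongrightarrow> c * q f P) U"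
      by (simp only: S_scale dualD(2)[OF f S_in_X[OF P]])
  qed
next
  fix P assume P: "P \<in> X"
  show "norm (q f P) \<le> dnorm f * nrm P"
    by (rule Lim_norm_ubound[OF U(2) q_tendsto[OF f P]]) (simp add: norm_f_S_le[OF f P])
next
  fix P assume "P \<notin> X" then show "q f P = 0" by (simp add: q_def)
qed

text \<open>
  Contractions that converge pointwise converge uniformly on totally bounded sets, such as the image of
  the unit ball under a member of \<open>J\<close>.
\<close>
lemma S_tendsto_on_J:
  assumes P: "P \<in> J" and e: "e > 0"
  shows "eventually (\<lambda>\<beta>. nrm (S \<beta> P - P) \<le> e) N"
proof -
  have PX: "P \<in> X" and wc: "weakly_cont_on_bounded sE P" using P by (simp_all add: polys_w_def)
  have e3: "e / 3 > 0" using e by simp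
  have "degree_le n P" using PX hom_poly_degree_le by (auto simp: polys_def)
  then obtain T where T: "finite T" "T \<subseteq> cball 0 1" "\<And>x. norm x \<le> 1 \<Longrightarrow> \<exists>t\<in>T. norm (P x - P t) < e / 3"
    using weakly_cont_image_totally_bounded[OF wc _ e3] by blast
  have "eventually (\<lambda>\<beta>. dist (L \<beta> (P t)) (P t) < e / 3) N" for t
    by (rule tendstoD[OF L_tendsto e3])
  then have "eventually (\<lambda>\<beta>. \<forall>t\<in>T. dist (L \<beta> (P t)) (P t) < e / 3) N"
    using T(1) by (simp add: eventually_ball_finite_distrib)
  then show ?thesis
  proof eventually_elim
    case (elim \<beta>)
    show ?case
    proof (rule poly_norm_le)
      fix x :: 'a assume "norm x \<le> 1"
      then obtain t where t: "t \<in> T" "norm (P x - P t) < e / 3" using T(3) by blast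
      have "L \<beta> (P x) - P x = L \<beta> (P x - P t) + (L \<beta> (P t) - P t) - (P x - P t)"
        by (simp add: linearD(4)[OF L_linear])
      then have "norm (L \<beta> (P x) - P x) \<le> norm (L \<beta> (P x - P t)) + norm (L \<beta> (P t) - P t) + norm (P x - P t)"
        using norm_triangle_ineq4[of "L \<beta> (P x - P t) + (L \<beta> (P t) - P t)" "P x - P t"]
          norm_triangle_ineq[of "L \<beta> (P x - P t)" "L \<beta> (P t) - P t"] by (simp only:)
      moreover have "norm (L \<beta> (P x - P t)) \<le> norm (P x - P t)" by (rule L_contraction)
      moreover have "norm (L \<beta> (P t) - P t) < e / 3" using elim t(1) by (simp add: dist_norm)
      ultimately have "norm (L \<beta> (P x) - P x) \<le> e" using t(2) by linarith
      then show "norm ((S \<beta> P - P) x) \<le> e" by (simp add: S_def)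
    qed
  qed
qed

lemma q_on_J:
  assumes f: "f \<in> D" and P: "P \<in> J"
  shows "q f P = f P"
proof (rule q_eqI[OF J_in_X[OF P]], rule tendstoI)
  fix e :: real assume e: "e > 0"
  define d where "d = e / (dnorm f + 1)"
  have d: "d > 0" "dnorm f * d < e" using e dual_norm_nonneg[OF f] by (simp_all add: d_def field_simps)
  have PX: "P \<in> X" by (rule J_in_X[OF P])
  have "eventually (\<lambda>\<beta>. nrm (S \<beta> P - P) \<le> d) U"
    using S_tendsto_on_J[OF P d(1)] U(1) by (rule filter_leD[rotated])
  then show "eventually (\<lambda>\<beta>. dist (f (S \<beta> P)) (f P) < e) U"
  proof eventually_elim
    case (elim \<beta>)
    have "norm (f (S \<beta> P - P)) \<le> dnorm f * nrm (S \<beta> P - P)"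
      by (rule norm_dual_le[OF f polys_diff[OF S_in_X[OF PX] PX]])
    also have "\<dots> \<le> dnorm f * d" by (rule mult_left_mono[OF elim dual_norm_nonneg[OF f]])
    also have "\<dots> < e" by (rule d(2))
    finally show ?case by (simp add: dual_diff[OF f S_in_X[OF PX] PX] dist_norm)
  qed
qed

lemma q_cong_on_J:
  assumes eq: "\<And>P. P \<in> J \<Longrightarrow> f P = g P"
  shows "q f = q g"
proof
  fix P show "q f P = q g P"
    using eq[OF S_in_J] by (simp add: q_def)
qed

lemma q_zero: "q 0 = 0"
proof
  fix P
  show "q 0 P = 0 P"
    by (cases "P \<in> X") (simp add: q_eqI, simp add: q_def)
qed

lemma ker_q: "{f \<in> D. q f = 0} = annihilator psc nrm X J"
proof -
  have "q f = 0 \<longleftrightarrow> (\<forall>P\<in>J. f P = 0)" if f: "f \<in> D" for f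
  proof
    assume "q f = 0"
    then show "\<forall>P\<in>J. f P = 0" using q_on_J[OF f] by (metis zero_fun_apply)
  next
    assume "\<forall>P\<in>J. f P = 0"
    then have "q f = q 0" by (intro q_cong_on_J) simp
    then show "q f = 0" by (simp only: q_zero)
  qed
  then show ?thesis unfolding annihilator_def by blast
qed

lemma dual_norm_complement:
  assumes f: "f \<in> D"
  shows "dnorm (f - q f) \<le> dnorm f"
proof (rule dual_norm_least)
  fix P assume P: "P \<in> X" "nrm P \<le> 1"
  have "((\<lambda>\<beta>. f P - f (S \<beta> P)) \<longlongrightarrow> f P - q f P) U"
    by (intro tendsto_diff tendsto_const q_tendsto f P)
  moreover have "norm (f P - f (S \<beta> P)) \<le> dnorm f" for \<beta>
  proof -
    have "norm (f (P - S \<beta> P)) \<le> dnorm f"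
      using poly_norm_diff_S[OF P(1)] P(2)
      by (intro dual_norm_upper[OF f polys_diff[OF P(1) S_in_X[OF P(1)]]]) (rule order_trans)
    then show ?thesis by (simp only: dual_diff[OF f P(1) S_in_X[OF P(1)]])
  qed
  ultimately have "norm (f P - q f P) \<le> dnorm f"
    by (intro Lim_norm_ubound[OF U(2)]) (auto intro: always_eventually)
  then show "norm ((f - q f) P) \<le> dnorm f" by simp
qed

lemma unit_scalar:
  obtains c :: "'k" where "norm c = 1" "c * a = of_real (norm a)"
proof (cases "a = 0")
  case True then show ?thesis by (intro that[of 1]) simp_all
next
  case False then show ?thesis by (intro that[of "of_real (norm a) / a"]) (simp_all add: norm_divide)
qed

text \<open>
  The bound on \<open>L \<beta> y + \<mu> (z - L \<beta> z)\<close> transfers pointwise to the polynomials \<open>S \<beta> P + \<mu> (Q - S \<beta> Q)\<close>,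
  on which \<open>f\<close> tends to \<open>q f P + \<mu> (f - q f) Q\<close>. Multiplying \<open>P\<close> and \<open>Q\<close> by scalars of modulus one
  aligns the two terms, and no cancellation is left.
\<close>
lemma dual_norm_sum_bound:
  assumes f: "f \<in> D" and \<mu>: "\<mu> > 0"
    and ev: "eventually (\<lambda>\<beta>. \<forall>y z. norm y \<le> 1 \<longrightarrow> norm z \<le> 1 \<longrightarrow>
        norm (L \<beta> y + \<mu> *\<^sub>R (z - L \<beta> z)) \<le> 1 + \<epsilon> * \<mu>) N"
    and P: "P \<in> X" "nrm P \<le> 1" and Q: "Q \<in> X" "nrm Q \<le> 1"
  shows "norm (q f P) + \<mu> * norm ((f - q f) Q) \<le> dnorm f * (1 + \<epsilon> * \<mu>)"
proof -
  obtain a :: 'k where a: "norm a = 1" "a * q f P = of_real (norm (q f P))" by (rule unit_scalar)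
  obtain b :: 'k where b: "norm b = 1" "b * (f - q f) Q = of_real (norm ((f - q f) Q))" by (rule unit_scalar)
  define R where "R \<beta> = psc a (S \<beta> P) + psc (of_real \<mu> * b) (Q - S \<beta> Q)" for \<beta>
  have RX: "R \<beta> \<in> X" for \<beta>
    unfolding R_def by (intro polys_add polys_scale polys_diff S_in_X P Q)
  have fR: "f (R \<beta>) = a * f (S \<beta> P) + of_real \<mu> * b * (f Q - f (S \<beta> Q))" for \<beta>
    unfolding R_def using P(1) Q(1)
    by (simp only: dualD(1,2)[OF f] dual_diff[OF f] polys_scale polys_diff S_in_X)
  have "((\<lambda>\<beta>. f (R \<beta>)) \<longlongrightarrow> a * q f P + of_real \<mu> * b * (f Q - q f Q)) U"
    unfolding fR by (intro tendsto_intros q_tendsto f P Q)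
  also have "a * q f P + of_real \<mu> * b * (f Q - q f Q) = of_real (norm (q f P) + \<mu> * norm ((f - q f) Q))"
    using a(2) b(2) by (simp add: mult.assoc)
  finally have lim: "((\<lambda>\<beta>. f (R \<beta>)) \<longlongrightarrow> of_real (norm (q f P) + \<mu> * norm ((f - q f) Q))) U" .
  have "eventually (\<lambda>\<beta>. norm (f (R \<beta>)) \<le> dnorm f * (1 + \<epsilon> * \<mu>)) U"
    using filter_leD[OF U(1) ev]
  proof eventually_elim
    case (elim \<beta>)
    have "nrm (R \<beta>) \<le> 1 + \<epsilon> * \<mu>"
    proof (rule poly_norm_le)
      fix x :: 'a assume x: "norm x \<le> 1"
      have "norm (sF a (P x)) \<le> 1" "norm (sF b (Q x)) \<le> 1"
        using norm_le_poly_norm[OF P(1) x] norm_le_poly_norm[OF Q(1) x] P(2) Q(2)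
        by (simp_all add: F.norm_scale a(1) b(1))
      then have "norm (L \<beta> (sF a (P x)) + \<mu> *\<^sub>R (sF b (Q x) - L \<beta> (sF b (Q x)))) \<le> 1 + \<epsilon> * \<mu>"
        using elim by blast
      moreover have "R \<beta> x = L \<beta> (sF a (P x)) + \<mu> *\<^sub>R (sF b (Q x) - L \<beta> (sF b (Q x)))"
        by (simp only: R_def plus_fun_apply minus_apply pointwise_scale_def S_def linearD(2)[OF L_linear]
            F.scale_right_diff_distrib[symmetric] F.scale_scale[symmetric] F.scale_of_real)
      ultimately show "norm (R \<beta> x) \<le> 1 + \<epsilon> * \<mu>" by simp
    qed
    then show ?case
      using norm_dual_le[OF f RX] mult_left_mono[OF _ dual_norm_nonneg[OF f]] order_trans by blast
  qed
  then have "norm (of_real (norm (q f P) + \<mu> * norm ((f - q f) Q)) :: 'k) \<le> dnorm f * (1 + \<epsilon> * \<mu>)"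
    by (rule Lim_norm_ubound[OF U(2) lim])
  moreover have "0 \<le> norm (q f P) + \<mu> * norm ((f - q f) Q)" using \<mu> by simp
  ultimately show ?thesis by (simp only: norm_of_real abs_of_nonneg)
qed

text \<open>
  If \<open>f \<noteq> q f\<close>, then \<open>f - q f\<close> has some value of modulus \<open>c > 0\<close> on the unit ball, and the previous
  bound gives \<open>dnorm (q f) \<le> dnorm f + \<mu> (\<epsilon> dnorm f - c)\<close>. So any \<open>\<epsilon>\<close> with \<open>\<epsilon> dnorm f < c\<close> will do.
\<close>
lemma dual_norm_q_less:
  assumes f: "f \<in> D" and ne: "f \<noteq> q f"
  shows "dnorm (q f) < dnorm f"
proof -
  obtain P where P: "f P \<noteq> q f P" using ne by auto
  then have PX: "P \<in> X" using dualD(3)[OF f] dualD(3)[OF q_in_dual[OF f]] by metis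
  have "nrm P \<noteq> 0"
    using P norm_dual_le[OF f PX] norm_dual_le[OF q_in_dual[OF f] PX] by auto
  then have p: "nrm P > 0" using poly_norm_nonneg[OF PX] by simp
  define Q where "Q = psc (of_real (inverse (nrm P))) P"
  have Q: "Q \<in> X" "nrm Q \<le> 1" unfolding Q_def by (rule normalize[OF PX p])+
  define c where "c = norm ((f - q f) Q)"
  have "(f - q f) Q = of_real (inverse (nrm P)) * (f P - q f P)"
    unfolding Q_def
    by (simp add: dualD(2)[OF f PX] dualD(2)[OF q_in_dual[OF f] PX] right_diff_distrib)
  then have c: "c > 0" using P p by (simp add: c_def)
  define \<epsilon> where "\<epsilon> = c / (dnorm f + 1)"
  have \<epsilon>: "\<epsilon> > 0" "dnorm f * \<epsilon> < c" using c dual_norm_nonneg[OF f] by (simp_all add: \<epsilon>_def field_simps)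
  obtain \<mu> where \<mu>: "\<mu> > 0" and ev: "eventually (\<lambda>\<beta>. \<forall>y z. norm y \<le> 1 \<longrightarrow> norm z \<le> 1 \<longrightarrow>
        norm (L \<beta> y + \<mu> *\<^sub>R (z - L \<beta> z)) \<le> 1 + \<epsilon> * \<mu>) N" using L_combination[OF \<epsilon>(1)] by blast
  have "dnorm (q f) \<le> dnorm f * (1 + \<epsilon> * \<mu>) - \<mu> * c"
  proof (rule dual_norm_least)
    fix R assume "R \<in> X" "nrm R \<le> 1"
    from dual_norm_sum_bound[OF f \<mu> ev this Q]
    show "norm (q f R) \<le> dnorm f * (1 + \<epsilon> * \<mu>) - \<mu> * c" by (simp add: c_def)
  qed
  also have "\<dots> = dnorm f + \<mu> * (dnorm f * \<epsilon> - c)" by (simp add: algebra_simps)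
  also have "\<dots> < dnorm f" using \<mu> \<epsilon>(2) by (simp add: mult_pos_neg)
  finally show ?thesis .
qed

lemma HB_subspace_polys_w: "HB_subspace psc nrm X J"
  unfolding HB_subspace_def
proof (intro conjI exI[of _ q])
  show "closed_subspace psc nrm X J" by (rule closed_subspace_polys_w)
  show "q \<in> D \<rightarrow> D" using q_in_dual by blast
  show "linear_on_carrier D (pointwise_scale (*)) (pointwise_scale (*)) q"
    unfolding linear_on_carrier_def
  proof (intro conjI ballI allI)
    fix f g assume f: "f \<in> D" and g: "g \<in> D"
    show "q (f + g) = q f + q g"
    proof
      fix P show "q (f + g) P = (q f + q g) P"
      proof (cases "P \<in> X")
        case True
        have "((\<lambda>\<beta>. f (S \<beta> P) + g (S \<beta> P)) \<longlongrightarrow> q f P + q g P) U"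
          by (intro tendsto_add q_tendsto f g True)
        then show ?thesis by (simp add: q_eqI[OF True])
      qed (simp add: q_def)
    qed
  next
    fix c f assume f: "f \<in> D"
    show "q (pointwise_scale (*) c f) = pointwise_scale (*) c (q f)"
    proof
      fix P show "q (pointwise_scale (*) c f) P = pointwise_scale (*) c (q f) P"
      proof (cases "P \<in> X")
        case True
        have "((\<lambda>\<beta>. c * f (S \<beta> P)) \<longlongrightarrow> c * q f P) U"
          by (intro tendsto_mult tendsto_const q_tendsto f True)
        then show ?thesis by (simp add: q_eqI[OF True] pointwise_scale_def)
      qed (simp add: q_def pointwise_scale_def)
    qed
  qed
  show "\<forall>f\<in>D. q (q f) = q f"
    using q_cong_on_J q_on_J by blast
  show "{f \<in> D. q f = 0} = annihilator psc nrm X J" by (rule ker_q)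
  show "\<forall>f\<in>D. f \<noteq> q f \<longrightarrow> dnorm (q f) < dnorm f \<and> dnorm (f - q f) \<le> dnorm f"
    using dual_norm_q_less dual_norm_complement by blast
qed

end

section \<open>Nets as filters, and the conclusion\<close>

lemma eventually_net_filter:
  assumes "directed_preorder le"
  shows "eventually Q (net_filter le) \<longleftrightarrow> (\<exists>b. \<forall>c. le b c \<longrightarrow> Q c)"
proof -
  have "eventually Q (net_filter le) \<longleftrightarrow> (\<exists>b\<in>UNIV. eventually Q (principal {c. le b c}))"
    unfolding net_filter_def
  proof (rule eventually_INF_base)
    fix a b
    obtain c where c: "le a c" "le b c" using assms unfolding directed_preorder_def by blast
    have "transp le" using assms by (simp add: directed_preorder_def)
    then have "{d. le c d} \<subseteq> {d. le a d} \<inter> {d. le b d}" using c by (auto dest: transpD)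
    then show "\<exists>c\<in>UNIV. principal {d. le c d} \<le> inf (principal {d. le a d}) (principal {d. le b d})"
      by auto
  qed simp
  then show ?thesis by (simp add: eventually_principal)
qed

theorem theorem3p5:
  fixes sE :: "'k::real_or_complex \<Rightarrow> 'a::banach \<Rightarrow> 'a"
    and sF :: "'k \<Rightarrow> 'b::banach \<Rightarrow> 'b"
    and n :: nat
    and le :: "'i \<Rightarrow> 'i \<Rightarrow> bool"
    and L :: "'i \<Rightarrow> 'b \<Rightarrow> 'b"
  assumes "banach_over sE" and "banach_over sF"
    and "1 \<le> n" and "enat n < critical_degree sE"
    and "metric_compact_approx_identity sF le L"
    and "\<And>\<beta>. onorm (\<lambda>y. y - L \<beta> y) \<le> 1"
    and "\<And>\<epsilon>::real. \<epsilon> > 0 \<Longrightarrow> \<exists>\<mu>>0. \<exists>\<beta>0. \<forall>\<beta>. le \<beta>0 \<beta> \<longrightarrow>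
           (SUP (y, z)\<in>cball 0 1 \<times> cball 0 1. norm (L \<beta> y + \<mu> *\<^sub>R (z - L \<beta> z))) \<le> 1 + \<epsilon> * \<mu>"
  shows "HB_subspace (pointwise_scale sF) poly_norm (polys n sE sF) (polys_w n sE sF)"
proof -
  have dir: "directed_preorder le" and comp: "\<And>\<beta>. compact_operator sF (L \<beta>)"
    and on: "\<And>\<beta>. onorm (L \<beta>) \<le> 1" and lim: "\<And>y. ((\<lambda>\<beta>. L \<beta> y) \<longlongrightarrow> y) (net_filter le)"
    using assms(5) by (simp_all add: metric_compact_approx_identity_def)
  have bl: "bounded_linear (L \<beta>)" for \<beta> using comp by (simp add: compact_operator_def)
  have contr: "norm (T y) \<le> norm y" if "bounded_linear T" "onorm T \<le> 1" for T :: "'b \<Rightarrow> 'b" and y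
    using onorm[OF that(1), of y] mult_right_mono[OF that(2), of "norm y"] by simp
  have L1: "norm (L \<beta> y) \<le> norm y" for \<beta> y by (rule contr[OF bl on])
  have L2: "norm (y - L \<beta> y) \<le> norm y" for \<beta> y
    by (rule contr[OF bounded_linear_sub[OF bounded_linear_ident bl] assms(6)])
  interpret compact_approximation sE sF n L "net_filter le"
  proof (intro compact_approximation.intro polynomials.intro polynomials_axioms.intro
      compact_approximation_axioms.intro)
    show "net_filter le \<noteq> bot"
      unfolding trivial_limit_def eventually_net_filter[OF dir]
      using dir by (auto simp: directed_preorder_def dest: reflpD)
    fix \<epsilon> :: real assume "\<epsilon> > 0"
    from assms(7)[OF this] obtain \<mu> \<beta>0 where \<mu>: "\<mu> > 0" and sup: "\<And>\<beta>. le \<beta>0 \<beta> \<Longrightarrow>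
      (SUP (y, z)\<in>cball 0 1 \<times> cball 0 1. norm (L \<beta> y + \<mu> *\<^sub>R (z - L \<beta> z))) \<le> 1 + \<epsilon> * \<mu>" by blast
    have "norm (L \<beta> y + \<mu> *\<^sub>R (z - L \<beta> z)) \<le> 1 + \<epsilon> * \<mu>"
      if "le \<beta>0 \<beta>" "norm y \<le> 1" "norm z \<le> 1" for \<beta> y z
    proof -
      let ?h = "\<lambda>(y, z). norm (L \<beta> y + \<mu> *\<^sub>R (z - L \<beta> z))"
      have "bdd_above (?h ` (cball 0 1 \<times> cball 0 1))"
      proof (rule bdd_aboveI2)
        fix p :: "'b \<times> 'b" assume p: "p \<in> cball 0 1 \<times> cball 0 1"
        obtain y z where yz: "p = (y, z)" by (rule prod.exhaust)
        have "norm (L \<beta> y) \<le> 1" using L1[of \<beta> y] p yz by simp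
        moreover have "norm (\<mu> *\<^sub>R (z - L \<beta> z)) \<le> \<mu>"
          using L2[of z \<beta>] p yz \<mu> by (simp add: mult_left_le)
        ultimately show "?h p \<le> 1 + \<mu>"
          using norm_triangle_ineq[of "L \<beta> y" "\<mu> *\<^sub>R (z - L \<beta> z)"] by (simp add: yz)
      qed
      then have "?h (y, z) \<le> (SUP p\<in>cball 0 1 \<times> cball 0 1. ?h p)"
        by (rule cSUP_upper[rotated]) (use that in simp)
      then show ?thesis using sup[OF that(1)] by simp
    qed
    then show "\<exists>\<mu>>0. eventually (\<lambda>\<beta>. \<forall>y z. norm y \<le> 1 \<longrightarrow> norm z \<le> 1 \<longrightarrow>
        norm (L \<beta> y + \<mu> *\<^sub>R (z - L \<beta> z)) \<le> 1 + \<epsilon> * \<mu>) (net_filter le)"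
      unfolding eventually_net_filter[OF dir] using \<mu> by blast
  qed (fact assms comp L1 L2 lim)+
  show ?thesis by (rule HB_subspace_polys_w)
qed

end
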